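(* The following assertions hold: (i) If $a\in(\mathfrak u_{\mathrm{res}})_*$ and $ia\ge0$, then $a\in\mathfrak S_1(\mathcal H)$ and $\|a\|_1\le\|a\|_{(\mathfrak u_{\mathrm{res}})_*}\le(1+\sqrt2)\|a\|_1$. (ii) If $\rho\in(\mathfrak u_{\mathrm{res}})_*\setminus\mathfrak u_1$, then there exist no $\rho_1,\rho_2\in(\mathfrak u_{\mathrm{res}})_*$ such that $i\rho_1\ge0$, $i\rho_2\ge0$, and $\rho=\rho_1-\rho_2$.
   Context: $\mathcal H=\mathcal H_+\oplus\mathcal H_-$ is a separable complex Hilbert space written as an orthogonal sum of two closed infinite-dimensional subspaces, $p_\pm$ are the orthogonal projections onto $\mathcal H_\pm$, $d=i(p_+-p_-)$. $\mathfrak S_1,\mathfrak S_2$ denote trace class and Hilbert-Schmidt operators, with norms $\|\cdot\|_1,\|\cdot\|_2$. $(\mathfrak u_{\mathrm{res}})_*=\{\rho\in\mathcal B(\mathcal H)\mid\rho^*=-\rho,\ [d,\rho]\in\mathfrak S_2(\mathcal H),\ p_\pm\rho|_{\mathcal H_\pm}\in\mathfrak S_1(\mathcal H_\pm)\}$. The norm on it is $\|\rho\|_{(\mathfrak u_{\mathrm{res}})_*}=\|\rho_{++}\|_1+\|\rho_{--}\|_1+2\|\rho_{+-}\|_2$, where $\rho_{++},\rho_{--},\rho_{+-}$ are the blocks of $\rho$ with respect to $\mathcal H=\mathcal H_+\oplus\mathcal H_-$ ($\rho_{+-}:\mathcal H_-\to\mathcal H_+$). $\mathfrak u_1=\{a\in\mathfrak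 S_1(\mathcal H)\mid a^*=-a\}$. For a self-adjoint operator $T$, $T\ge0$ means positive semidefinite. *)

theory Defs
  imports "HOL-Analysis.Analysis"
begin

section \<open>Complex Hilbert spaces\<close>

text \<open>
  The inner product is antilinear in its first argument. The underlying real inner product (and
  hence norm and topology) is its real part, so positive definiteness is inherited from
  \<^class>\<open>real_inner\<close>.
\<close>

class complex_inner = real_inner +
  fixes scaleC :: "complex \<Rightarrow> 'a \<Rightarrow> 'a" (infixr "*\<^sub>C" 75)
    and cinner :: "'a \<Rightarrow> 'a \<Rightarrow> complex"
  assumes scaleC_add_right: "c *\<^sub>C (x + y) = c *\<^sub>C x + c *\<^sub>C y"
    and scaleC_add_left: "(b + c) *\<^sub>C x = b *\<^sub>C x + c *\<^sub>C x"
    and scaleC_scaleC: "b *\<^sub>C (c *\<^sub>C x) = (b * c) *\<^sub>C x"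
    and scaleC_one: "1 *\<^sub>C x = x"
    and scaleR_eq_scaleC: "r *\<^sub>R x = complex_of_real r *\<^sub>C x"
    and cinner_commute: "cinner x y = cnj (cinner y x)"
    and cinner_add_right: "cinner x (y + z) = cinner x y + cinner x z"
    and cinner_scaleC_right: "cinner x (c *\<^sub>C y) = c * cinner x y"
    and inner_eq_Re_cinner: "inner x y = Re (cinner x y)"

class chilbert_space = complex_inner + complete_space

global_interpretation complex_vector: vector_space "scaleC :: complex \<Rightarrow> 'a \<Rightarrow> 'a::complex_inner"
  defines csubspace = complex_vector.subspace
    and cspan = complex_vector.span
  by unfold_locales
    (simp_all add: scaleC_add_right scaleC_add_left scaleC_scaleC scaleC_one)

definition onb :: "'a::complex_inner set \<Rightarrow> 'a set \<Rightarrow> bool" where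
  "onb M E \<longleftrightarrow> E \<subseteq> M \<and> (\<forall>e\<in>E. \<forall>f\<in>E. cinner e f = (if e = f then 1 else 0))
     \<and> closure (cspan E) = M"

definition orth_proj :: "'a::complex_inner set \<Rightarrow> 'a \<Rightarrow> 'a" where
  "orth_proj M x = (THE y. y \<in> M \<and> (\<forall>z\<in>M. cinner z (x - y) = 0))"


section \<open>Operators on closed subspaces\<close>

text \<open>
  Operators act on closed subspaces \<open>M\<close>, \<open>N\<close> of an ambient Hilbert space. They are total functions
  of which only the values on the domain \<open>M\<close> matter; operators on the whole space are the case
  \<open>M = UNIV\<close>.
\<close>

definition bounded_op :: "'a::complex_inner set \<Rightarrow> 'a set \<Rightarrow> ('a \<Rightarrow> 'a) \<Rightarrow> bool" where
  "bounded_op M N A \<longleftrightarrow>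
     (\<forall>x\<in>M. A x \<in> N) \<and>
     (\<forall>x\<in>M. \<forall>y\<in>M. A (x + y) = A x + A y) \<and>
     (\<forall>c. \<forall>x\<in>M. A (c *\<^sub>C x) = c *\<^sub>C A x) \<and>
     (\<exists>K. \<forall>x\<in>M. norm (A x) \<le> K * norm x)"

text \<open>The adjoint of an operator with domain \<open>M\<close>; its values lie in \<open>M\<close>.\<close>

definition adj :: "'a::complex_inner set \<Rightarrow> ('a \<Rightarrow> 'a) \<Rightarrow> 'a \<Rightarrow> 'a" where
  "adj M A y = (THE z. z \<in> M \<and> (\<forall>x\<in>M. cinner (A x) y = cinner x z))"

text \<open>For self-adjoint \<open>T\<close> the numbers \<open>cinner x (T x)\<close> are real.\<close>

definition positive_op :: "'a::complex_inner set \<Rightarrow> ('a \<Rightarrow> 'a) \<Rightarrow> bool" where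
  "positive_op M T \<longleftrightarrow> bounded_op M M T \<and> (\<forall>x\<in>M. adj M T x = T x) \<and>
     (\<forall>x\<in>M. 0 \<le> Re (cinner x (T x)))"

text \<open>
  \<open>|A|\<close>, the positive square root of \<open>A\<^sup>*A\<close>. It is determined uniquely on \<open>M\<close>, but not outside
  of \<open>M\<close>.
\<close>

definition abs_op :: "'a::complex_inner set \<Rightarrow> ('a \<Rightarrow> 'a) \<Rightarrow> 'a \<Rightarrow> 'a" where
  "abs_op M A = (SOME S. positive_op M S \<and> (\<forall>x\<in>M. S (S x) = adj M A (A x)))"

text \<open>
  Neither summability nor the values of the sums below depend on the choice of the orthonormal
  basis.
\<close>

definition trace_class :: "'a::complex_inner set \<Rightarrow> ('a \<Rightarrow> 'a) \<Rightarrow> bool" where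
  "trace_class M A \<longleftrightarrow> bounded_op M M A \<and>
     (\<exists>E. onb M E \<and> (\<lambda>e. Re (cinner e (abs_op M A e))) summable_on E)"

definition trace_norm :: "'a::complex_inner set \<Rightarrow> ('a \<Rightarrow> 'a) \<Rightarrow> real" where
  "trace_norm M A = (\<Sum>\<^sub>\<infinity>e\<in>(SOME E. onb M E). Re (cinner e (abs_op M A e)))"

definition hilbert_schmidt :: "'a::complex_inner set \<Rightarrow> 'a set \<Rightarrow> ('a \<Rightarrow> 'a) \<Rightarrow> bool" where
  "hilbert_schmidt M N A \<longleftrightarrow> bounded_op M N A \<and>
     (\<exists>E. onb M E \<and> (\<lambda>e. (norm (A e))\<^sup>2) summable_on E)"

definition hs_norm :: "'a::complex_inner set \<Rightarrow> ('a \<Rightarrow> 'a) \<Rightarrow> real" where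
  "hs_norm M A = sqrt (\<Sum>\<^sub>\<infinity>e\<in>(SOME E. onb M E). (norm (A e))\<^sup>2)"


section \<open>The predual of the restricted unitary Lie algebra\<close>

definition d_op :: "'a::complex_inner set \<Rightarrow> 'a set \<Rightarrow> 'a \<Rightarrow> 'a" where
  "d_op Hp Hm x = \<i> *\<^sub>C (orth_proj Hp x - orth_proj Hm x)"

definition skew_adjoint :: "('a::complex_inner \<Rightarrow> 'a) \<Rightarrow> bool" where
  "skew_adjoint A \<longleftrightarrow> adj UNIV A = (\<lambda>x. - A x)"

text \<open>
  The block of \<open>\<rho>\<close> with values in \<open>M\<close>; its domain \<open>Hp\<close> or \<open>Hm\<close> is supplied where it is used.
\<close>

definition block :: "'a::complex_inner set \<Rightarrow> ('a \<Rightarrow> 'a) \<Rightarrow> 'a \<Rightarrow> 'a" where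
  "block M \<rho> x = orth_proj M (\<rho> x)"

definition u_res_predual :: "'a::complex_inner set \<Rightarrow> 'a set \<Rightarrow> ('a \<Rightarrow> 'a) set" where
  "u_res_predual Hp Hm = {\<rho>. bounded_op UNIV UNIV \<rho> \<and> skew_adjoint \<rho> \<and>
     hilbert_schmidt UNIV UNIV (\<lambda>x. d_op Hp Hm (\<rho> x) - \<rho> (d_op Hp Hm x)) \<and>
     trace_class Hp (block Hp \<rho>) \<and> trace_class Hm (block Hm \<rho>)}"

definition u_res_predual_norm :: "'a::complex_inner set \<Rightarrow> 'a set \<Rightarrow> ('a \<Rightarrow> 'a) \<Rightarrow> real" where
  "u_res_predual_norm Hp Hm \<rho> =
     trace_norm Hp (block Hp \<rho>) + trace_norm Hm (block Hm \<rho>) + 2 * hs_norm Hm (block Hp \<rho>)"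

definition u_1 :: "('a::complex_inner \<Rightarrow> 'a) set" where
  "u_1 = {a. trace_class UNIV a \<and> skew_adjoint a}"

end

theory Submission
  imports Defs
begin

text \<open>
  If \<open>T = i a \<ge> 0\<close>, then \<open>|a| = T\<close> and the absolute values of the diagonal
  blocks of \<open>a\<close> are the diagonal blocks of \<open>T\<close>, so the trace
  of \<open>T\<close>, computed in a basis adapted to the splitting, is the sum of the traces of the two diagonal
  blocks. The Cauchy-Schwarz inequality for the form \<open>\<langle>x, T y\<rangle>\<close> gives
  \<open>\<parallel>a\<^sub>+\<^sub>-\<parallel>\<^sub>2\<^sup>2 \<le> \<parallel>a\<^sub>+\<^sub>+\<parallel>\<^sub>1 \<parallel>a\<^sub>-\<^sub>-\<parallel>\<^sub>1\<close>, whence \<open>2 \<parallel>a\<^sub>+\<^sub>-\<parallel>\<^sub>2 \<le> \<parallel>a\<parallel>\<^sub>1\<close>. For (ii), a difference of two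
  positive elements is a difference of trace class operators, hence lies in \<open>u_1\<close>; that \<open>|A|\<close>
  has finite trace for \<open>A = T\<^sub>1 - T\<^sub>2\<close> is read off a basis adapted to \<open>ker (|A| - A)\<close> and its
  complement, so neither compactness nor the polar decomposition is needed.
\<close>

section \<open>Real Hilbert spaces\<close>

lemma nonneg_quadratic_discriminant:
  fixes a b c :: real
  assumes "\<And>t. 0 \<le> a + 2 * t * b + t\<^sup>2 * c" and "0 \<le> c"
  shows "b\<^sup>2 \<le> a * c"
proof (cases "c = 0")
  case True
  have "b = 0"
  proof (rule ccontr)
    assume "b \<noteq> 0"
    then show False
      \<comment> \<open>This value of \<open>t\<close> gives \<open>a + 2 * t * b = - 1\<close>,
        contradicting nonnegativity.\<close>
      using assms(1)[of "- (a + 1) / (2 * b)"] True by (simp add: field_simps)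
  qed
  then show ?thesis using True by simp
next
  case False
  then have c: "c > 0" using assms(2) by simp
  then show ?thesis
    \<comment> \<open>The minimiser of the quadratic, where its value is
      \<open>a - b\<^sup>2 / c\<close>.\<close>
    using assms(1)[of "- b / c"] by (simp add: field_simps power2_eq_square)
qed

lemmas blinfun_compose_simps =
  bounded_bilinear.add_left[OF bounded_bilinear_blinfun_compose]
  bounded_bilinear.add_right[OF bounded_bilinear_blinfun_compose]
  bounded_bilinear.diff_left[OF bounded_bilinear_blinfun_compose]
  bounded_bilinear.diff_right[OF bounded_bilinear_blinfun_compose]
  bounded_bilinear.scaleR_left[OF bounded_bilinear_blinfun_compose]
  bounded_bilinear.scaleR_right[OF bounded_bilinear_blinfun_compose]

lemma blinfun_compose_assoc: "(A o\<^sub>L B) o\<^sub>L C = A o\<^sub>L (B o\<^sub>L C)"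
  by (rule blinfun_eqI) simp

lemma blinfun_compose_id: "A o\<^sub>L id_blinfun = A" "id_blinfun o\<^sub>L A = A"
  by (auto intro: blinfun_eqI)

text \<open>Positivity at \<open>x + t *\<^sub>R y\<close> for every real \<open>t\<close> is a
  nonnegative quadratic in \<open>t\<close>, and its discriminant yields the claim.\<close>

lemma positive_form_Cauchy_Schwarz:
  fixes T :: "'a::real_inner \<Rightarrow> 'a"
  assumes "linear T" and sym: "\<And>x y. inner (T x) y = inner x (T y)"
    and pos: "\<And>x. 0 \<le> inner x (T x)"
  shows "(inner x (T y))\<^sup>2 \<le> inner x (T x) * inner y (T y)"
proof (rule nonneg_quadratic_discriminant)
  fix t
  interpret linear T by fact
  have "inner y (T x) = inner x (T y)" by (metis sym inner_commute)
  then show "0 \<le> inner x (T x) + 2 * t * inner x (T y) + t\<^sup>2 * inner y (T y)"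
    using pos[of "x + t *\<^sub>R y"]
    by (simp add: add scale inner_add_left inner_add_right power2_eq_square algebra_simps)
qed (rule pos)

text \<open>Cauchy-Schwarz for the pair \<open>T x\<close>, \<open>x\<close> bounds
  \<open>norm (T x) ^ 4\<close> by a multiple of \<open>inner x (T x)\<close>, which
  vanishes.\<close>

lemma positive_form_zero:
  fixes T :: "'a::real_inner \<Rightarrow> 'a"
  assumes "linear T" "\<And>x y. inner (T x) y = inner x (T y)"
    and "\<And>x. 0 \<le> inner x (T x)" and "inner x (T x) = 0"
  shows "T x = 0"
  using positive_form_Cauchy_Schwarz[OF assms(1-3), of "T x" x] assms(4) by simp

text \<open>This turns a bound on the form into a bound on the operator. Cauchy-Schwarz for
  \<open>T x\<close>, \<open>x\<close> together with \<open>le\<close> at both vectors bounds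
  \<open>norm (T x) ^ 4\<close> by \<open>norm (T x) ^ 2 * norm x ^ 2\<close>; a nonzero factor
  cancels.\<close>

lemma positive_form_norm_le:
  fixes T :: "'a::real_inner \<Rightarrow> 'a"
  assumes "linear T" "\<And>x y. inner (T x) y = inner x (T y)"
    and "\<And>x. 0 \<le> inner x (T x)" and le: "\<And>x. inner x (T x) \<le> (norm x)\<^sup>2"
  shows "norm (T x) \<le> norm x"
proof (cases "T x = 0")
  case False
  have "((norm (T x))\<^sup>2)\<^sup>2 \<le> inner (T x) (T (T x)) * inner x (T x)"
    using positive_form_Cauchy_Schwarz[OF assms(1-3), of "T x" x] by (simp add: power2_norm_eq_inner)
  also have "\<dots> \<le> (norm (T x))\<^sup>2 * (norm x)\<^sup>2"
    by (intro mult_mono le assms(3)) simp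
  finally have "(norm (T x))\<^sup>2 \<le> (norm x)\<^sup>2"
    using False by (simp add: power2_eq_square)
  then show ?thesis by (simp add: power_mono_iff)
qed simp

section \<open>Existence and uniqueness of positive square roots\<close>

lemma sqrt_iteration_scalar:
  fixes y :: "nat \<Rightarrow> real"
  assumes "y 0 = 0" and "\<And>n. y (Suc n) = (1 + (y n)\<^sup>2) / 2"
  shows "0 \<le> y n" "y n \<le> 1" "y n \<le> y (Suc n)"
proof -
  have *: "0 \<le> y n \<and> y n \<le> 1" for n
    by (induction n) (auto simp: assms power_le_one)
  then show "0 \<le> y n" "y n \<le> 1" by auto
  \<comment> \<open>The increment equals \<open>(y n - 1)\<^sup>2 / 2\<close>.\<close>
  show "y n \<le> y (Suc n)" using sum_squares_ge_zero[of "y n - 1" 0]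
    by (simp add: assms power2_eq_square algebra_simps)
qed

text \<open>
  For \<open>T = 1 - B\<close> with \<open>0 \<le> B \<le> 1\<close>, a fixed point \<open>Y\<close> of \<open>Y \<mapsto> (B + Y\<^sup>2) / 2\<close> gives
  the root \<open>1 - Y\<close>. The increments of the iteration are dominated in norm by those of the scalar
  iteration \<open>y \<mapsto> (1 + y\<^sup>2) / 2\<close>, so it converges in the operator norm.
\<close>

lemma contractive_positive_sqrt_exists:
  fixes T :: "'a::{real_inner,banach} \<Rightarrow>\<^sub>L 'a"
  assumes sym: "\<And>x y. inner (T x) y = inner x (T y)" and pos: "\<And>x. 0 \<le> inner x (T x)"
    and le: "\<And>x. inner x (T x) \<le> (norm x)\<^sup>2"
  obtains S :: "'a \<Rightarrow>\<^sub>L 'a" where "\<And>x y. inner (S x) y = inner x (S y)" "\<And>x. 0 \<le> inner x (S x)"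
    "S o\<^sub>L S = T" "\<And>C. C o\<^sub>L T = T o\<^sub>L C \<Longrightarrow> C o\<^sub>L S = S o\<^sub>L C"
proof -
  note distr = blinfun_compose_simps
  define B where "B = id_blinfun - T"
  have B: "B x = x - T x" for x by (simp add: B_def blinfun.bilinear_simps)
  have Bsym: "inner (B x) y = inner x (B y)" for x y
    by (simp add: B sym inner_diff_left inner_diff_right)
  \<comment> \<open>For \<open>B = 1 - T\<close> the two bounds on \<open>T\<close> exchange roles:
    \<open>le\<close> makes \<open>B\<close> positive and \<open>pos\<close> keeps it below the
    identity.\<close>
  have nB: "norm B \<le> 1"
  proof (rule norm_blinfun_bound)
    show "norm (B x) \<le> 1 * norm x" for x
      using positive_form_norm_le[of B x] Bsym le pos
      by (simp add: blinfun.bounded_linear_right bounded_linear.linear B inner_diff_right power2_norm_eq_inner)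
  qed simp
  define Y where "Y = rec_nat (0 :: 'a \<Rightarrow>\<^sub>L 'a) (\<lambda>_ Z. (1/2) *\<^sub>R (B + (Z o\<^sub>L Z)))"
  have Y0: "Y 0 = 0" and YS: "Y (Suc n) = (1/2) *\<^sub>R (B + (Y n o\<^sub>L Y n))" for n
    by (simp_all add: Y_def)
  define y :: "nat \<Rightarrow> real" where "y = rec_nat 0 (\<lambda>_ z. (1 + z\<^sup>2) / 2)"
  have y0: "y 0 = 0" and yS: "y (Suc n) = (1 + (y n)\<^sup>2) / 2" for n by (simp_all add: y_def)
  note y = sqrt_iteration_scalar[of y, OF y0 yS]
  have nY: "norm (Y n) \<le> y n" for n
  proof (induction n)
    case (Suc n)
    have "norm (B + (Y n o\<^sub>L Y n)) \<le> 1 + norm (Y n) * norm (Y n)"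
      using norm_triangle_ineq[of B "Y n o\<^sub>L Y n"] nB norm_blinfun_compose[of "Y n" "Y n"] by linarith
    also have "\<dots> \<le> 1 + y n * y n" using Suc y(1) by (intro add_left_mono mult_mono) auto
    finally show ?case by (simp add: YS yS power2_eq_square)
  qed (simp add: Y0 y0)
  have commB: "C o\<^sub>L Y n = Y n o\<^sub>L C" if "C o\<^sub>L B = B o\<^sub>L C" for C n
  proof (induction n)
    case (Suc n)
    have "C o\<^sub>L (Y n o\<^sub>L Y n) = (Y n o\<^sub>L Y n) o\<^sub>L C" by (metis Suc blinfun_compose_assoc)
    then show ?case by (simp add: YS distr that)
  qed (simp add: Y0 blinfun_compose_simps)
  \<comment> \<open>Using \<open>commB\<close> first with \<open>C = B\<close> and then with
    \<open>C = Y n\<close> shows that all iterates commute. This is what lets the difference of two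
    squares factor in \<open>dY\<close>.\<close>
  have YB: "Y n o\<^sub>L B = B o\<^sub>L Y n" for n using commB[of B n] by simp
  have YY: "Y n o\<^sub>L Y m = Y m o\<^sub>L Y n" for n m using commB[OF YB] .
  have dY: "norm (Y (Suc n) - Y n) \<le> y (Suc n) - y n" for n
  proof (induction n)
    case 0 show ?case using nY[of 1] by (simp add: Y0 y0)
  next
    case (Suc n)
    have "Y (Suc (Suc n)) - Y (Suc n) = (1/2) *\<^sub>R ((Y (Suc n) + Y n) o\<^sub>L (Y (Suc n) - Y n))"
      by (subst (1 2) YS) (simp add: distr YY[of n "Suc n"] algebra_simps)
    then have "norm (Y (Suc (Suc n)) - Y (Suc n)) \<le> (1/2) * (norm (Y (Suc n) + Y n) * norm (Y (Suc n) - Y n))"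
      using norm_blinfun_compose[of "Y (Suc n) + Y n" "Y (Suc n) - Y n"] by simp
    also have "\<dots> \<le> (1/2) * ((y (Suc n) + y n) * (y (Suc n) - y n))"
      using norm_triangle_ineq[of "Y (Suc n)" "Y n"] nY[of n] nY[of "Suc n"] Suc
        y(1)[of n] y(1)[of "Suc n"]
      by (intro mult_left_mono mult_mono) auto
    also have "\<dots> = y (Suc (Suc n)) - y (Suc n)"
      by (subst (3 4) yS) (simp add: power2_eq_square field_simps)
    finally show ?case .
  qed
  \<comment> \<open>The scalar sequence is monotone and bounded, so its increments telescope to a
    convergent series, which dominates the operator increments.\<close>
  have summ_y: "summable (\<lambda>n. y (Suc n) - y n)"
  proof -
    have "incseq y" using y(3) by (simp add: incseq_Suc_iff)
    then obtain L where "y \<longlonglongrightarrow> L"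
      using incseq_convergent[of y 1] y(2) by metis
    then show ?thesis using telescope_summable by blast
  qed
  have "summable (\<lambda>n. Y (Suc n) - Y n)"
    by (rule summable_comparison_test'[OF summ_y, of 0]) (use dY in auto)
  then obtain s where "(\<lambda>n. Y (Suc n) - Y n) sums s" by (auto simp: summable_def)
  then have "(\<lambda>n. \<Sum>k<n. Y (Suc k) - Y k) \<longlonglongrightarrow> s" by (simp add: sums_def)
  then have Ylim: "Y \<longlonglongrightarrow> s" by (simp add: sum_lessThan_telescope Y0)
  note comp_lim = bounded_bilinear.tendsto[OF bounded_bilinear_blinfun_compose]
  have "(\<lambda>n. Y (Suc n)) \<longlonglongrightarrow> (1/2) *\<^sub>R (B + (s o\<^sub>L s))"
    unfolding YS by (intro tendsto_intros comp_lim Ylim)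
  then have fixpt: "s = (1/2) *\<^sub>R (B + (s o\<^sub>L s))"
    using LIMSEQ_Suc[OF Ylim] LIMSEQ_unique by blast
  have ns: "norm s \<le> 1"
    by (rule LIMSEQ_le_const2[OF tendsto_norm[OF Ylim]]) (use nY y(2) order_trans in blast)
  have app: "(\<lambda>n. Y n x) \<longlonglongrightarrow> s x" for x
    by (intro tendsto_intros Ylim)
  have Ysym: "inner (Y n x) z = inner x (Y n z)" for n x z
    by (induction n arbitrary: x z)
      (simp_all add: Y0 YS blinfun.bilinear_simps inner_add_left inner_add_right Bsym)
  have ssym: "inner (s x) z = inner x (s z)" for x z
  proof (rule LIMSEQ_unique)
    show "(\<lambda>n. inner (Y n x) z) \<longlonglongrightarrow> inner (s x) z" by (intro tendsto_intros app)
    show "(\<lambda>n. inner (Y n x) z) \<longlonglongrightarrow> inner x (s z)" unfolding Ysym by (intro tendsto_intros app)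
  qed
  show thesis
  proof
    show "inner ((id_blinfun - s) x) z = inner x ((id_blinfun - s) z)" for x z
      by (simp add: blinfun.bilinear_simps inner_diff_left inner_diff_right ssym)
    show "0 \<le> inner x ((id_blinfun - s) x)" for x
    proof -
      have "inner x (s x) \<le> norm x * norm (s x)" by (rule norm_cauchy_schwarz)
      also have "\<dots> \<le> norm x * (norm s * norm x)" by (intro mult_left_mono norm_blinfun) auto
      also have "\<dots> \<le> norm x * (1 * norm x)" by (intro mult_left_mono mult_right_mono ns) auto
      finally show ?thesis
        by (simp add: blinfun.bilinear_simps inner_diff_right power2_norm_eq_inner[symmetric] power2_eq_square)
    qed
    \<comment> \<open>By the fixed point equation,
      \<open>(1 - s)\<^sup>2 = 1 - 2 s + s\<^sup>2 = 1 - B = T\<close>.\<close>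
    have "2 *\<^sub>R s = B + (s o\<^sub>L s)" by (subst fixpt) simp
    then show "(id_blinfun - s) o\<^sub>L (id_blinfun - s) = T"
      by (simp add: distr blinfun_compose_id B_def scaleR_2 algebra_simps)
    show "C o\<^sub>L (id_blinfun - s) = (id_blinfun - s) o\<^sub>L C" if "C o\<^sub>L T = T o\<^sub>L C" for C
    proof -
      have "C o\<^sub>L B = B o\<^sub>L C" using that by (simp add: B_def distr blinfun_compose_id)
      then have CY: "C o\<^sub>L Y n = Y n o\<^sub>L C" for n by (rule commB)
      have "C o\<^sub>L s = s o\<^sub>L C"
      proof (rule LIMSEQ_unique)
        show "(\<lambda>n. C o\<^sub>L Y n) \<longlonglongrightarrow> (C o\<^sub>L s)" by (intro comp_lim tendsto_const Ylim)
        show "(\<lambda>n. C o\<^sub>L Y n) \<longlonglongrightarrow> (s o\<^sub>L C)"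
          unfolding CY by (intro comp_lim tendsto_const Ylim)
      qed
      then show ?thesis by (simp add: distr blinfun_compose_id)
    qed
  qed
qed

text \<open>Dividing by \<open>norm T\<close> reduces to the contractive case, and the factor
  returns as \<open>sqrt (norm T)\<close>. The commutation clause is kept because both uniqueness
  and complex linearity of the root rest on it.\<close>

lemma positive_sqrt_exists:
  fixes T :: "'a::{real_inner,banach} \<Rightarrow>\<^sub>L 'a"
  assumes sym: "\<And>x y. inner (T x) y = inner x (T y)" and pos: "\<And>x. 0 \<le> inner x (T x)"
  obtains S :: "'a \<Rightarrow>\<^sub>L 'a" where "\<And>x y. inner (S x) y = inner x (S y)" "\<And>x. 0 \<le> inner x (S x)"
    "S o\<^sub>L S = T" "\<And>C. C o\<^sub>L T = T o\<^sub>L C \<Longrightarrow> C o\<^sub>L S = S o\<^sub>L C"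
proof (cases "T = 0")
  case True
  then show ?thesis
    by (intro that[of 0]) (auto simp: blinfun_compose_simps)
next
  case False
  define r where "r = norm T"
  have r: "r > 0" using False by (simp add: r_def)
  obtain S :: "'a \<Rightarrow>\<^sub>L 'a" where S: "\<And>x y. inner (S x) y = inner x (S y)"
    "\<And>x. 0 \<le> inner x (S x)" "S o\<^sub>L S = (1/r) *\<^sub>R T"
    and comm: "\<And>C. C o\<^sub>L (1/r) *\<^sub>R T = (1/r) *\<^sub>R T o\<^sub>L C \<Longrightarrow> C o\<^sub>L S = S o\<^sub>L C"
  proof (rule contractive_positive_sqrt_exists[of "(1/r) *\<^sub>R T"])
    show "inner x (((1/r) *\<^sub>R T) x) \<le> (norm x)\<^sup>2" for x
    proof -
      have "inner x (T x) \<le> norm x * norm (T x)" by (rule norm_cauchy_schwarz)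
      also have "\<dots> \<le> norm x * (r * norm x)"
        unfolding r_def by (intro mult_left_mono norm_blinfun) auto
      finally show ?thesis using r
        by (simp add: blinfun.bilinear_simps power2_eq_square field_simps)
    qed
    show "inner (((1/r) *\<^sub>R T) x) y = inner x (((1/r) *\<^sub>R T) y)" for x y
      by (simp add: blinfun.bilinear_simps sym)
    show "0 \<le> inner x (((1/r) *\<^sub>R T) x)" for x
      using pos r by (simp add: blinfun.bilinear_simps)
  qed (rule that)
  show ?thesis
  proof (rule that[of "sqrt r *\<^sub>R S"])
    show "inner ((sqrt r *\<^sub>R S) x) y = inner x ((sqrt r *\<^sub>R S) y)" for x y
      by (simp add: blinfun.bilinear_simps S)
    show "0 \<le> inner x ((sqrt r *\<^sub>R S) x)" for x
      using S(2) r by (simp add: blinfun.bilinear_simps)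
    show "(sqrt r *\<^sub>R S) o\<^sub>L (sqrt r *\<^sub>R S) = T"
      unfolding blinfun_compose_simps S(3) scaleR_scaleR using r by simp
    show "C o\<^sub>L (sqrt r *\<^sub>R S) = (sqrt r *\<^sub>R S) o\<^sub>L C" if "C o\<^sub>L T = T o\<^sub>L C" for C
      unfolding blinfun_compose_simps
      by (subst comm) (simp_all only: blinfun_compose_simps that)
  qed
qed

text \<open>Both roots are compared with the constructed root \<open>B\<close>. A root
  \<open>R\<close> commutes with its own square, hence with \<open>B\<close>, so
  \<open>(B + R) (B - R) = 0\<close>; positivity then annihilates the range of \<open>B - R\<close>
  under \<open>B\<close> and \<open>R\<close> separately.\<close>

lemma positive_sqrt_unique:
  fixes S S' :: "'a::{real_inner,banach} \<Rightarrow>\<^sub>L 'a"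
  assumes sym: "\<And>x y. inner (S x) y = inner x (S y)" and pos: "\<And>x. 0 \<le> inner x (S x)"
    and sym': "\<And>x y. inner (S' x) y = inner x (S' y)" and pos': "\<And>x. 0 \<le> inner x (S' x)"
    and eq: "S o\<^sub>L S = S' o\<^sub>L S'"
  shows "S = S'"
proof -
  have "inner x ((S o\<^sub>L S) x) \<ge> 0" for x by (metis sym inner_ge_zero blinfun_apply_blinfun_compose)
  moreover have "inner ((S o\<^sub>L S) x) y = inner x ((S o\<^sub>L S) y)" for x y by (simp add: sym)
  ultimately obtain B :: "'a \<Rightarrow>\<^sub>L 'a" where B: "\<And>x y. inner (B x) y = inner x (B y)" "\<And>x. 0 \<le> inner x (B x)"
    "B o\<^sub>L B = S o\<^sub>L S" and comm: "\<And>C. C o\<^sub>L (S o\<^sub>L S) = (S o\<^sub>L S) o\<^sub>L C \<Longrightarrow> C o\<^sub>L B = B o\<^sub>L C"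
    using positive_sqrt_exists[of "S o\<^sub>L S"] by blast
  have uniq: "B = R" if R: "\<And>x y. inner (R x) y = inner x (R y)" "\<And>x. 0 \<le> inner x (R x)"
    "R o\<^sub>L R = S o\<^sub>L S" for R :: "'a \<Rightarrow>\<^sub>L 'a"
  proof (rule blinfun_eqI)
    fix x
    have "R o\<^sub>L B = B o\<^sub>L R" by (rule comm) (metis R(3) blinfun_compose_assoc)
    then have RB: "R (B u) = B (R u)" for u by (metis blinfun_apply_blinfun_compose)
    have RR: "R (R u) = B (B u)" for u by (metis blinfun_apply_blinfun_compose B(3) R(3))
    define z where "z = B x - R x"
    have "B z + R z = 0" by (simp add: z_def blinfun.bilinear_simps RB RR)
    then have "inner z (B z) + inner z (R z) = 0" by (metis inner_add_right inner_zero_right)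
    then have "inner z (B z) = 0" "inner z (R z) = 0" using B(2)[of z] R(2)[of z] by linarith+
    then have Bz: "B z = 0" and Rz: "R z = 0"
      using positive_form_zero[of B z] positive_form_zero[of R z] B R
      by (auto simp: blinfun.bounded_linear_right bounded_linear.linear)
    \<comment> \<open>One factor \<open>B - R\<close> of \<open>z = (B - R) x\<close> is moved
      across by symmetry and meets \<open>B z = R z = 0\<close>.\<close>
    have "inner z z = inner x (B z - R z)"
      by (simp add: z_def inner_diff_left inner_diff_right B(1) R(1) blinfun.bilinear_simps)
    then have "z = 0" using Bz Rz by simp
    then show "B x = R x" by (simp add: z_def)
  qed
  show ?thesis using uniq[OF sym pos refl] uniq[OF sym' pos' eq[symmetric]] by simp
qed

section \<open>The projection theorem and the Riesz representation theorem\<close>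

lemma closed_subspace_projection_exists:
  fixes M :: "'a::{real_inner,banach} set"
  assumes sub: "subspace M" and "closed M"
  shows "\<exists>y\<in>M. \<forall>z\<in>M. inner z (x - y) = 0"
proof -
  define D where "D = (INF y\<in>M. (norm (x - y))\<^sup>2)"
  have ne: "M \<noteq> {}" using sub subspace_0 by blast
  have bdd: "bdd_below ((\<lambda>y. (norm (x - y))\<^sup>2) ` M)" by (rule bdd_belowI[of _ 0]) auto
  have D: "D \<le> (norm (x - y))\<^sup>2" if "y \<in> M" for y
    unfolding D_def by (rule cINF_lower[OF bdd that])
  have "\<exists>y\<in>M. (norm (x - y))\<^sup>2 < D + 1 / real (Suc n)" for n
    using cINF_less_iff[OF ne bdd, of "D + 1 / real (Suc n)"] by (simp add: D_def)
  then obtain f where fM: "\<And>n. f n \<in> M" and f: "\<And>n. (norm (x - f n))\<^sup>2 < D + 1 / real (Suc n)"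
    by metis
  \<comment> \<open>Parallelogram law for \<open>x - u\<close> and \<open>x - v\<close>: the
    midpoint of \<open>u\<close> and \<open>v\<close> lies in \<open>M\<close>, hence at squared
    distance at least \<open>D\<close> from \<open>x\<close>. Near-minimisers are therefore close
    together, so a minimising sequence is Cauchy.\<close>
  have par: "(norm (u - v))\<^sup>2 \<le> 2 * ((norm (x - u))\<^sup>2 - D) + 2 * ((norm (x - v))\<^sup>2 - D)"
    if "u \<in> M" "v \<in> M" for u v
  proof -
    have "(1/2) *\<^sub>R (u + v) \<in> M" using that sub by (simp add: subspace_add subspace_scale)
    from D[OF this] have "4 * D \<le> (norm (2 *\<^sub>R (x - (1/2) *\<^sub>R (u + v))))\<^sup>2"
      by (simp add: power_mult_distrib)
    also have "2 *\<^sub>R (x - (1/2) *\<^sub>R (u + v)) = (x - u) + (x - v)"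
      by (simp add: algebra_simps scaleR_2)
    finally have "4 * D \<le> (norm ((x - u) + (x - v)))\<^sup>2" .
    moreover have "(norm ((x - u) + (x - v)))\<^sup>2 + (norm (u - v))\<^sup>2
        = 2 * (norm (x - u))\<^sup>2 + 2 * (norm (x - v))\<^sup>2"
      by (simp add: power2_norm_eq_inner inner_add_left inner_add_right inner_diff_left
          inner_diff_right inner_commute)
    ultimately show ?thesis by argo
  qed
  have "Cauchy f"
  proof (rule metric_CauchyI)
    fix e :: real assume e: "e > 0"
    \<comment> \<open>The bound \<open>e\<^sup>2 / 4\<close> on each excess over \<open>D\<close> is
      chosen so that the right side of \<open>par\<close> stays below
      \<open>e\<^sup>2\<close>.\<close>
    obtain N where N: "1 / real (Suc N) < e\<^sup>2 / 4"
      using reals_Archimedean[of "e\<^sup>2 / 4"] e by (auto simp: inverse_eq_divide)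
    have small: "(norm (x - f n))\<^sup>2 - D < e\<^sup>2 / 4" if "n \<ge> N" for n
    proof -
      have "1 / real (Suc n) \<le> 1 / real (Suc N)" using that by (simp add: frac_le)
      then show ?thesis using f[of n] N by linarith
    qed
    have "dist (f m) (f n) < e" if "m \<ge> N" "n \<ge> N" for m n
    proof -
      have "(norm (f m - f n))\<^sup>2 < e\<^sup>2"
        using par[OF fM fM, of m n] small[OF that(1)] small[OF that(2)] by argo
      then show ?thesis using e by (simp add: dist_norm power_less_imp_less_base)
    qed
    then show "\<exists>N. \<forall>m\<ge>N. \<forall>n\<ge>N. dist (f m) (f n) < e" by blast
  qed
  then obtain y where y: "f \<longlonglongrightarrow> y" using Cauchy_convergent convergent_def by blast
  have yM: "y \<in> M" using closed_sequentially[OF \<open>closed M\<close>] fM y by blast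
  have "(norm (x - y))\<^sup>2 \<le> D + 0"
  proof (rule LIMSEQ_le)
    show "(\<lambda>n. (norm (x - f n))\<^sup>2) \<longlonglongrightarrow> (norm (x - y))\<^sup>2" by (intro tendsto_intros y)
    show "(\<lambda>n. D + 1 / real (Suc n)) \<longlonglongrightarrow> D + 0"
      using LIMSEQ_inverse_real_of_nat by (intro tendsto_intros) (simp add: inverse_eq_divide)
  qed (use f less_imp_le in blast)
  then have min: "(norm (x - y))\<^sup>2 \<le> (norm (x - z))\<^sup>2" if "z \<in> M" for z
    using D[OF that] by linarith
  have "inner z (x - y) = 0" if z: "z \<in> M" for z
  proof -
    \<comment> \<open>Minimality of \<open>y\<close> against the competitors
      \<open>y + t *\<^sub>R z\<close>. The constant term is 0, so the discriminant criterion forces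
      the linear coefficient to vanish.\<close>
    have "0 \<le> 0 + 2 * t * (- inner z (x - y)) + t\<^sup>2 * inner z z" for t
    proof -
      have "y + t *\<^sub>R z \<in> M" using yM z sub by (simp add: subspace_add subspace_scale)
      from min[OF this] show ?thesis unfolding power2_norm_eq_inner
        by (simp add: inner_add_left inner_add_right inner_diff_left
            inner_diff_right inner_commute power2_eq_square algebra_simps)
    qed
    from nonneg_quadratic_discriminant[OF this] show ?thesis by simp
  qed
  then show ?thesis using yM by blast
qed

text \<open>A vector \<open>w\<close> orthogonal to the kernel of \<open>f\<close> and outside it
  spans a complement of the kernel, so a suitable multiple of \<open>w\<close> represents
  \<open>f\<close>.\<close>

lemma Riesz_representation:
  fixes f :: "'a::{real_inner,banach} \<Rightarrow> real"
  assumes "bounded_linear f"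
  shows "\<exists>z. \<forall>x. f x = inner x z"
proof (cases "\<forall>x. f x = 0")
  case True
  then show ?thesis by (intro exI[of _ 0]) auto
next
  case False
  interpret bounded_linear f by fact
  obtain x where x: "f x \<noteq> 0" using False by blast
  define M where "M = {x. f x = 0}"
  have "subspace M" by (auto simp: subspace_def M_def add scale)
  moreover have "closed M" unfolding M_def
    by (intro closed_Collect_eq continuous_intros linear_continuous_on \<open>bounded_linear f\<close>)
  ultimately obtain y where y: "y \<in> M" "\<And>z. z \<in> M \<Longrightarrow> inner z (x - y) = 0"
    using closed_subspace_projection_exists by blast
  define w where "w = x - y"
  have fw: "f w \<noteq> 0" using x y(1) by (simp add: w_def diff M_def)
  then have w: "w \<noteq> 0" using zero by auto
  have "f u = inner u ((f w / inner w w) *\<^sub>R w)" for u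
  proof -
    \<comment> \<open>The kernel component of \<open>u\<close>, which is orthogonal to
      \<open>w\<close>.\<close>
    have "u - (f u / f w) *\<^sub>R w \<in> M" using fw by (simp add: M_def diff scale)
    from y(2)[OF this] have "inner u w = (f u / f w) * inner w w"
      by (simp add: inner_diff_left w_def)
    then show ?thesis using fw w by simp
  qed
  then show ?thesis by blast
qed

section \<open>Complex Hilbert spaces\<close>

instance chilbert_space \<subseteq> banach ..

section \<open>Complex inner products and their reduction to the real inner product\<close>

lemma cinner_add_left: "cinner (x + y) z = cinner x z + cinner y z"
  by (metis cinner_commute cinner_add_right complex_cnj_add)

lemma cinner_scaleC_left: "cinner (c *\<^sub>C x) y = cnj c * cinner x y"
  by (metis cinner_commute cinner_scaleC_right complex_cnj_mult)

lemma cinner_zero_right [simp]: "cinner x 0 = 0"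
  using cinner_add_right[of x 0 0] by simp

lemma cinner_zero_left [simp]: "cinner 0 x = 0"
  using cinner_add_left[of 0 0 x] by simp

lemma cinner_minus_right: "cinner x (- y) = - cinner x y"
  using cinner_add_right[of x y "- y"] by (simp add: eq_neg_iff_add_eq_0 add.commute)

lemma cinner_minus_left: "cinner (- x) y = - cinner x y"
  using cinner_add_left[of x "- x" y] by (simp add: eq_neg_iff_add_eq_0 add.commute)

lemma cinner_diff_right: "cinner x (y - z) = cinner x y - cinner x z"
  using cinner_add_right[of x y "- z"] by (simp add: cinner_minus_right)

lemma cinner_diff_left: "cinner (x - y) z = cinner x z - cinner y z"
  using cinner_add_left[of x "- y" z] by (simp add: cinner_minus_left)

lemma cinner_sum_right: "cinner x (\<Sum>i\<in>I. f i) = (\<Sum>i\<in>I. cinner x (f i))"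
  by (induction I rule: infinite_finite_induct) (simp_all add: cinner_add_right)

lemmas cinner_simps = cinner_add_left cinner_add_right cinner_diff_left cinner_diff_right
  cinner_minus_left cinner_minus_right cinner_scaleC_left cinner_scaleC_right

lemma cinner_self: "cinner x x = complex_of_real ((norm x)\<^sup>2)"
proof (rule complex_eqI)
  show "Re (cinner x x) = Re (complex_of_real ((norm x)\<^sup>2))"
    by (simp add: inner_eq_Re_cinner[symmetric] power2_norm_eq_inner)
  have "Im (cinner x x) = - Im (cinner x x)"
    by (subst cinner_commute) simp
  then show "Im (cinner x x) = Im (complex_of_real ((norm x)\<^sup>2))" by simp
qed

lemma cinner_commute_eq_0: "cinner x y = 0 \<longleftrightarrow> cinner y x = 0"
  by (metis cinner_commute complex_cnj_zero)

lemma norm_scaleC: "norm (c *\<^sub>C x) = cmod c * norm x"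
proof -
  have "complex_of_real ((norm (c *\<^sub>C x))\<^sup>2) = c * cnj c * complex_of_real ((norm x)\<^sup>2)"
    by (simp only: cinner_self[symmetric] cinner_simps mult.assoc mult.left_commute)
  also have "\<dots> = complex_of_real ((cmod c * norm x)\<^sup>2)"
    by (simp only: complex_norm_square[symmetric] of_real_mult[symmetric] of_real_power[symmetric]
        power_mult_distrib)
  finally have "(norm (c *\<^sub>C x))\<^sup>2 = (cmod c * norm x)\<^sup>2" by (simp only: of_real_eq_iff)
  then show ?thesis by simp
qed

lemma cinner_Cauchy_Schwarz: "cmod (cinner x y) \<le> norm x * norm y"
proof (cases "cinner x y = 0")
  case False
  \<comment> \<open>The phase \<open>w\<close> rotates the inner product onto the nonnegative real
    axis, where the real Cauchy-Schwarz inequality applies.\<close>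
  define w where "w = sgn (cinner x y)"
  have "cinner (w *\<^sub>C x) y = complex_of_real (cmod (cinner x y))"
    using False by (simp add: cinner_simps w_def sgn_div_norm scaleR_conv_of_real complex_norm_square[symmetric]
        field_simps power2_eq_square)
  then have "cmod (cinner x y) = inner (w *\<^sub>C x) y" by (simp add: inner_eq_Re_cinner)
  also have "\<dots> \<le> norm (w *\<^sub>C x) * norm y" by (rule norm_cauchy_schwarz)
  finally show ?thesis using False by (simp add: norm_scaleC w_def norm_sgn)
qed simp

lemma bounded_linear_scaleC: "bounded_linear ((*\<^sub>C) c)"
  by (rule bounded_linear_intro[where K = "cmod c"])
    (simp_all add: scaleC_add_right scaleR_eq_scaleC scaleC_scaleC norm_scaleC mult.commute)

lemma csubspace_imp_subspace: "csubspace M \<Longrightarrow> subspace M"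
  unfolding complex_vector.subspace_def subspace_def by (simp add: scaleR_eq_scaleC)

text \<open>Real Hilbert space arguments only deliver real parts. Replacing \<open>x\<close> by
  \<open>\<i> *\<^sub>C x\<close> converts imaginary parts into real ones.\<close>

lemma cinner_eqI_real:
  assumes "\<And>x. x \<in> M \<Longrightarrow> Re (cinner (f x) y) = Re (cinner x z)"
    and "csubspace M" and "\<And>c x. x \<in> M \<Longrightarrow> f (c *\<^sub>C x) = c *\<^sub>C f x" and "x \<in> M"
  shows "cinner (f x) y = cinner x z"
proof (rule complex_eqI)
  have "\<i> *\<^sub>C x \<in> M" using assms complex_vector.subspace_scale by blast
  from assms(1)[OF this] show "Im (cinner (f x) y) = Im (cinner x z)"
    using assms(3,4) by (simp add: cinner_simps)
qed (use assms in blast)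

subsection \<open>Orthogonal projections\<close>

lemma orth_proj_eqI:
  assumes "csubspace M" "y \<in> M" "\<And>z. z \<in> M \<Longrightarrow> cinner z (x - y) = 0"
  shows "orth_proj M x = y"
  unfolding orth_proj_def
proof (rule the_equality)
  fix v assume v: "v \<in> M \<and> (\<forall>z\<in>M. cinner z (x - v) = 0)"
  then have "y - v \<in> M" using assms complex_vector.subspace_diff by blast
  then have "cinner (y - v) (x - v) - cinner (y - v) (x - y) = 0" using v assms(3) by simp
  then have "cinner (y - v) (y - v) = 0" by (simp add: cinner_diff_right)
  then show "v = y" by (simp add: cinner_self)
qed (use assms in blast)

text \<open>The real projection onto \<open>M\<close> is also the complex one, because
  \<open>M\<close> is stable under multiplication by \<i>.\<close>

lemma orth_proj_characterization:
  fixes M :: "'a::chilbert_space set"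
  assumes M: "csubspace M" "closed M"
  shows "orth_proj M x \<in> M \<and> (\<forall>z\<in>M. cinner z (x - orth_proj M x) = 0)"
proof -
  obtain y where y: "y \<in> M" "\<And>z. z \<in> M \<Longrightarrow> inner z (x - y) = 0"
    using closed_subspace_projection_exists[OF csubspace_imp_subspace[OF M(1)] M(2)] by blast
  have "cinner z (x - y) = 0" if z: "z \<in> M" for z
  proof (rule complex_eqI)
    have "\<i> *\<^sub>C z \<in> M" using z M complex_vector.subspace_scale by blast
    from y(2)[OF this] show "Im (cinner z (x - y)) = Im 0"
      by (simp add: inner_eq_Re_cinner cinner_scaleC_left)
  qed (use y z in \<open>simp add: inner_eq_Re_cinner\<close>)
  then show ?thesis using orth_proj_eqI[OF M(1) y(1)] y(1) by metis
qed

lemmas orth_proj_in = orth_proj_characterization[THEN conjunct1]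

lemma orth_proj_id: "csubspace M \<Longrightarrow> x \<in> M \<Longrightarrow> orth_proj M x = x"
  by (rule orth_proj_eqI) simp_all

lemma cinner_orth_proj_right:
  fixes M :: "'a::chilbert_space set"
  assumes "csubspace M" "closed M" "z \<in> M"
  shows "cinner z (orth_proj M x) = cinner z x"
  using orth_proj_characterization[OF assms(1,2), of x] assms(3) by (simp add: cinner_diff_right)

lemma cinner_orth_proj_left:
  fixes M :: "'a::chilbert_space set"
  assumes "csubspace M" "closed M" "z \<in> M"
  shows "cinner (orth_proj M x) z = cinner x z"
  using cinner_orth_proj_right[OF assms, of x] by (metis cinner_commute)

lemma norm_orth_proj_le:
  fixes M :: "'a::chilbert_space set"
  assumes "csubspace M" "closed M"
  shows "norm (orth_proj M x) \<le> norm x"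
proof (cases "orth_proj M x = 0")
  case False
  have "complex_of_real ((norm (orth_proj M x))\<^sup>2) = cinner (orth_proj M x) x"
    using cinner_orth_proj_right[OF assms orth_proj_in[OF assms]] by (simp only: cinner_self[symmetric])
  then have "(norm (orth_proj M x))\<^sup>2 \<le> norm (orth_proj M x) * norm x"
    using cinner_Cauchy_Schwarz[of "orth_proj M x" x] by (metis norm_of_real abs_of_nonneg zero_le_power2)
  then show ?thesis using False by (simp add: power2_eq_square)
qed simp

lemma bounded_op_orth_proj:
  fixes M :: "'a::chilbert_space set"
  assumes M: "csubspace M" "closed M"
  shows "bounded_op UNIV M (orth_proj M)"
proof -
  note M' = orth_proj_in[OF M] complex_vector.subspace_add[OF M(1)] complex_vector.subspace_scale[OF M(1)]
  have "orth_proj M (x + y) = orth_proj M x + orth_proj M y" for x y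
    by (rule orth_proj_eqI[OF M(1)])
      (simp_all add: M' cinner_diff_right cinner_add_right cinner_orth_proj_right[OF M])
  moreover have "orth_proj M (c *\<^sub>C x) = c *\<^sub>C orth_proj M x" for c x
    by (rule orth_proj_eqI[OF M(1)])
      (simp_all add: M' cinner_diff_right cinner_scaleC_right cinner_orth_proj_right[OF M])
  moreover have "\<exists>K. \<forall>x. norm (orth_proj M x) \<le> K * norm x"
    by (rule exI[of _ 1]) (simp add: norm_orth_proj_le[OF M])
  ultimately show ?thesis by (simp add: bounded_op_def orth_proj_in[OF M])
qed

subsection \<open>Bounded operators and adjoints\<close>

lemma bounded_op_scaleC: "bounded_op M N A \<Longrightarrow> x \<in> M \<Longrightarrow> A (c *\<^sub>C x) = c *\<^sub>C A x"
  by (simp add: bounded_op_def)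

lemma bounded_op_iff:
  "bounded_op UNIV UNIV A \<longleftrightarrow> bounded_linear A \<and> (\<forall>c x. A (c *\<^sub>C x) = c *\<^sub>C A x)"
proof
  assume A: "bounded_op UNIV UNIV A"
  then obtain K where "\<And>x. norm (A x) \<le> K * norm x" by (auto simp: bounded_op_def)
  then have "bounded_linear A"
    using A by (intro bounded_linear_intro[of _ K])
      (simp_all add: bounded_op_def scaleR_eq_scaleC mult.commute)
  then show "bounded_linear A \<and> (\<forall>c x. A (c *\<^sub>C x) = c *\<^sub>C A x)"
    using A by (simp add: bounded_op_def)
next
  assume A: "bounded_linear A \<and> (\<forall>c x. A (c *\<^sub>C x) = c *\<^sub>C A x)"
  then interpret bounded_linear A by blast
  obtain K where "\<And>x. norm (A x) \<le> norm x * K" using bounded by blast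
  then show "bounded_op UNIV UNIV A"
    using A by (auto simp: bounded_op_def add intro!: exI[of _ K] simp: mult.commute)
qed

lemma bounded_op_compose:
  assumes A: "bounded_op L M A" and B: "bounded_op M N B"
  shows "bounded_op L N (\<lambda>x. B (A x))"
proof -
  obtain K where K: "\<And>x. x \<in> L \<Longrightarrow> norm (A x) \<le> K * norm x" using A unfolding bounded_op_def by blast
  obtain K' where K': "\<And>x. x \<in> M \<Longrightarrow> norm (B x) \<le> K' * norm x" using B unfolding bounded_op_def by blast
  have "norm (B (A x)) \<le> (\<bar>K'\<bar> * K) * norm x" if "x \<in> L" for x
  proof -
    have "norm (B (A x)) \<le> K' * norm (A x)" using K' A that by (auto simp: bounded_op_def)
    also have "\<dots> \<le> \<bar>K'\<bar> * norm (A x)" by (intro mult_right_mono) auto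
    also have "\<dots> \<le> \<bar>K'\<bar> * (K * norm x)" by (intro mult_left_mono K that) auto
    finally show ?thesis by (simp add: mult.assoc)
  qed
  then show ?thesis using A B unfolding bounded_op_def by (auto intro!: exI[of _ "\<bar>K'\<bar> * K"])
qed

lemma bounded_op_mono: "bounded_op M N A \<Longrightarrow> L \<subseteq> M \<Longrightarrow> N \<subseteq> N' \<Longrightarrow> bounded_op L N' A"
  unfolding bounded_op_def by (blast intro: exI)

lemma bounded_op_compose_orth_proj:
  fixes M :: "'a::chilbert_space set"
  assumes "csubspace M" "closed M" "bounded_op M N A"
  shows "bounded_op UNIV UNIV (\<lambda>x. A (orth_proj M x))"
  using bounded_op_compose[OF bounded_op_orth_proj[OF assms(1,2)] assms(3)]
  by (rule bounded_op_mono) auto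

lemma adj_eqI:
  assumes "csubspace M" "z \<in> M" "\<And>x. x \<in> M \<Longrightarrow> cinner (A x) y = cinner x z"
  shows "adj M A y = z"
  unfolding adj_def
proof (rule the_equality)
  fix v assume v: "v \<in> M \<and> (\<forall>x\<in>M. cinner (A x) y = cinner x v)"
  then have "v - z \<in> M" using assms complex_vector.subspace_diff by blast
  then have "cinner (v - z) v = cinner (v - z) z" using v assms(3) by metis
  then have "cinner (v - z) (v - z) = 0" by (simp add: cinner_diff_right)
  then show "v = z" by (simp add: cinner_self)
qed (use assms in blast)

text \<open>Precomposing with the projection makes \<open>A\<close> a bounded operator on the whole
  space, to which the Riesz theorem applies; projecting the representing vector puts it into
  \<open>M\<close>.\<close>

lemma adj_characterization:
  fixes M :: "'a::chilbert_space set"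
  assumes M: "csubspace M" "closed M" and A: "bounded_op M N A"
  shows "adj M A y \<in> M \<and> (\<forall>x\<in>M. cinner (A x) y = cinner x (adj M A y))"
proof -
  have "bounded_linear (\<lambda>x. A (orth_proj M x))"
    using bounded_op_compose_orth_proj[OF M A] by (simp add: bounded_op_iff)
  then have "bounded_linear (\<lambda>x. inner (A (orth_proj M x)) y)"
    by (rule bounded_linear_compose[OF bounded_linear_inner_left])
  then obtain z where z: "\<And>x. inner (A (orth_proj M x)) y = inner x z"
    using Riesz_representation by blast
  have "Re (cinner (A x) y) = Re (cinner x (orth_proj M z))" if "x \<in> M" for x
    using z[of x] that by (simp add: orth_proj_id M inner_eq_Re_cinner cinner_orth_proj_right)
  then have "cinner (A x) y = cinner x (orth_proj M z)" if "x \<in> M" for x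
    using cinner_eqI_real[of M A y] M A that by (auto simp: bounded_op_def)
  then show ?thesis
    using adj_eqI[OF M(1) orth_proj_in[OF M]] orth_proj_in[OF M] by metis
qed

subsection \<open>Positive operators\<close>

lemma positive_opI:
  assumes "csubspace M" "bounded_op M M T"
    and "\<And>x y. x \<in> M \<Longrightarrow> y \<in> M \<Longrightarrow> cinner (T x) y = cinner x (T y)"
    and "\<And>x. x \<in> M \<Longrightarrow> 0 \<le> Re (cinner x (T x))"
  shows "positive_op M T"
  unfolding positive_op_def using assms by (auto intro!: adj_eqI simp: bounded_op_def)

lemma positive_op_cinner:
  fixes M :: "'a::chilbert_space set"
  assumes "csubspace M" "closed M" "positive_op M T" "x \<in> M" "y \<in> M"
  shows "cinner (T x) y = cinner x (T y)"
  using adj_characterization[OF assms(1,2), of M T y] assms by (auto simp: positive_op_def)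

text \<open>Extending \<open>T\<close> by zero on the orthogonal complement of \<open>M\<close>
  preserves symmetry and positivity, which makes the real square root results available for
  operators on \<open>M\<close>.\<close>

lemma positive_op_blinfun:
  fixes M :: "'a::chilbert_space set"
  assumes M: "csubspace M" "closed M" and T: "positive_op M T"
  defines "B \<equiv> Blinfun (\<lambda>x. T (orth_proj M x))"
  shows "blinfun_apply B = (\<lambda>x. T (orth_proj M x))"
    and "inner (B x) y = inner x (B y)" and "0 \<le> inner x (B x)"
proof -
  have bop: "bounded_op M M T" using T by (simp add: positive_op_def)
  have "bounded_linear (\<lambda>x. T (orth_proj M x))"
    using bounded_op_compose_orth_proj[OF M bop] by (simp add: bounded_op_iff)
  then show B: "blinfun_apply B = (\<lambda>x. T (orth_proj M x))"
    unfolding B_def by (rule bounded_linear_Blinfun_apply)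
  have in_M: "T (orth_proj M x) \<in> M" for x using bop orth_proj_in[OF M] by (simp add: bounded_op_def)
  have "cinner (B x) y = cinner (T (orth_proj M x)) (orth_proj M y)"
    unfolding B by (simp add: cinner_orth_proj_right[OF M in_M])
  also have "\<dots> = cinner (orth_proj M x) (T (orth_proj M y))"
    by (rule positive_op_cinner[OF M T orth_proj_in[OF M] orth_proj_in[OF M]])
  also have "\<dots> = cinner x (B y)"
    unfolding B by (simp add: cinner_orth_proj_left[OF M in_M])
  finally show "inner (B x) y = inner x (B y)" by (simp add: inner_eq_Re_cinner)
  have "cinner x (B x) = cinner (orth_proj M x) (T (orth_proj M x))"
    unfolding B by (simp add: cinner_orth_proj_left[OF M in_M])
  then show "0 \<le> inner x (B x)" using T orth_proj_in[OF M] by (simp add: inner_eq_Re_cinner positive_op_def)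
qed

lemma positive_op_sqrt_unique:
  fixes M :: "'a::chilbert_space set"
  assumes M: "csubspace M" "closed M" and S: "positive_op M S" and T: "positive_op M T"
    and eq: "\<And>x. x \<in> M \<Longrightarrow> S (S x) = T (T x)" and x: "x \<in> M"
  shows "S x = T x"
proof -
  note BS = positive_op_blinfun[OF M S] and BT = positive_op_blinfun[OF M T]
  have in_M: "S (orth_proj M y) \<in> M" "T (orth_proj M y) \<in> M" for y
    using S T orth_proj_in[OF M] by (simp_all add: bounded_op_def positive_op_def)
  have "Blinfun (\<lambda>x. S (orth_proj M x)) = Blinfun (\<lambda>x. T (orth_proj M x))"
  proof (rule positive_sqrt_unique[OF BS(2,3) BT(2,3)], rule blinfun_eqI)
    show "(Blinfun (\<lambda>x. S (orth_proj M x)) o\<^sub>L Blinfun (\<lambda>x. S (orth_proj M x))) y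
        = (Blinfun (\<lambda>x. T (orth_proj M x)) o\<^sub>L Blinfun (\<lambda>x. T (orth_proj M x))) y" for y
      by (simp add: BS(1) BT(1) orth_proj_id[OF M(1)] in_M eq orth_proj_in[OF M])
  qed
  then have "S (orth_proj M x) = T (orth_proj M x)" by (metis BS(1) BT(1))
  then show ?thesis using x by (simp add: orth_proj_id[OF M(1)])
qed

lemma positive_op_sqrt_exists:
  fixes T :: "'a::chilbert_space \<Rightarrow> 'a"
  assumes T: "positive_op UNIV T"
  obtains S where "positive_op UNIV S" "\<And>x. S (S x) = T x"
    "\<forall>C. bounded_linear C \<longrightarrow> (\<forall>x. C (T x) = T (C x)) \<longrightarrow> (\<forall>x. C (S x) = S (C x))"
proof -
  note U = complex_vector.subspace_UNIV closed_UNIV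
  note BT = positive_op_blinfun[OF U T, unfolded orth_proj_id[OF complex_vector.subspace_UNIV UNIV_I]]
  obtain S where S: "\<And>x y. inner (blinfun_apply S x) y = inner x (S y)" "\<And>x. 0 \<le> inner x (S x)"
    "S o\<^sub>L S = Blinfun T" and comm: "\<And>C. C o\<^sub>L Blinfun T = Blinfun T o\<^sub>L C \<Longrightarrow> C o\<^sub>L S = S o\<^sub>L C"
    using positive_sqrt_exists[OF BT(2,3)] by blast
  have SS: "S (S x) = T x" for x by (metis S(3) BT(1) blinfun_apply_blinfun_compose)
  have commS: "C (S x) = S (C x)" if C: "bounded_linear C" "\<And>x. C (T x) = T (C x)" for C x
  proof -
    have "Blinfun C o\<^sub>L Blinfun T = Blinfun T o\<^sub>L Blinfun C"
      by (rule blinfun_eqI) (simp add: BT(1) bounded_linear_Blinfun_apply C)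
    from comm[OF this] show ?thesis
      by (metis blinfun_apply_blinfun_compose bounded_linear_Blinfun_apply[OF C(1)])
  qed
  have "bounded_op UNIV UNIV T" using T by (simp add: positive_op_def)
  \<comment> \<open>The root comes from the real theory. Multiplication by \<open>c\<close> is a
    bounded real-linear map commuting with \<open>T\<close>, hence it commutes with \<open>S\<close>
    as well.\<close>
  then have Sc: "S (c *\<^sub>C x) = c *\<^sub>C S x" for c x
    using commS[OF bounded_linear_scaleC, of c] by (simp add: bounded_op_iff)
  have "positive_op UNIV (blinfun_apply S)"
  proof (rule positive_opI)
    show "bounded_op UNIV UNIV (blinfun_apply S)"
      by (simp add: bounded_op_iff blinfun.bounded_linear_right Sc)
    show "cinner (S x) y = cinner x (S y)" for x y
      by (rule cinner_eqI_real[of UNIV]) (simp_all add: Sc S(1)[unfolded inner_eq_Re_cinner])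
    show "0 \<le> Re (cinner x (S x))" for x using S(2) by (simp add: inner_eq_Re_cinner)
  qed simp
  then show thesis using that SS commS by blast
qed

text \<open>A known root \<open>S\<close> does double duty: it shows that the choice in
  \<open>abs_op\<close> is made among existing candidates, and uniqueness then fixes the chosen one
  on \<open>M\<close>.\<close>

lemma abs_op_eqI:
  fixes M :: "'a::chilbert_space set"
  assumes M: "csubspace M" "closed M" and S: "positive_op M S"
    and eq: "\<And>x. x \<in> M \<Longrightarrow> S (S x) = adj M A (A x)" and x: "x \<in> M"
  shows "abs_op M A x = S x"
proof -
  let ?R = "abs_op M A"
  have "positive_op M ?R \<and> (\<forall>x\<in>M. ?R (?R x) = adj M A (A x))"
    unfolding abs_op_def by (rule someI[of _ S]) (use S eq in blast)
  then show ?thesis using positive_op_sqrt_unique[OF M _ S _ x, of ?R] eq by simp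
qed

subsection \<open>Orthonormal bases\<close>

definition orthonormal :: "'a::complex_inner set \<Rightarrow> bool" where
  "orthonormal E \<longleftrightarrow> (\<forall>e\<in>E. \<forall>f\<in>E. cinner e f = (if e = f then 1 else 0))"

lemma onb_iff: "onb M E \<longleftrightarrow> E \<subseteq> M \<and> orthonormal E \<and> closure (cspan E) = M"
  by (simp add: onb_def orthonormal_def)

lemma orthonormal_Un:
  assumes E: "orthonormal E" and F: "orthonormal F"
    and EF: "\<And>e f. e \<in> E \<Longrightarrow> f \<in> F \<Longrightarrow> cinner e f = 0"
  shows "orthonormal (E \<union> F)" "E \<inter> F = {}"
proof -
  have ne: "e \<noteq> f" if "e \<in> E" "f \<in> F" for e f
    using EF[OF that] E that(1) by (metis orthonormal_def zero_neq_one)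
  then show "E \<inter> F = {}" by blast
  have FE: "cinner f e = 0" if "e \<in> E" "f \<in> F" for e f
    using EF[OF that] cinner_commute_eq_0 by blast
  show "orthonormal (E \<union> F)"
    unfolding orthonormal_def
  proof (intro ballI)
    fix e f assume "e \<in> E \<union> F" "f \<in> E \<union> F"
    then consider "e \<in> E" "f \<in> E" | "e \<in> F" "f \<in> F" | "e \<in> E" "f \<in> F" | "f \<in> E" "e \<in> F" by blast
    then show "cinner e f = (if e = f then 1 else 0)"
    proof cases
      case 3
      then show ?thesis using EF ne by simp
    next
      case 4
      then show ?thesis using FE[OF 4] ne[OF 4] by simp
    qed (use E F in \<open>simp_all add: orthonormal_def\<close>)
  qed
qed

lemma closure_csubspace:
  assumes S: "csubspace S"
  shows "csubspace (closure S)"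
  unfolding complex_vector.subspace_def
proof (intro conjI ballI allI)
  show "0 \<in> closure S" using S complex_vector.subspace_0 closure_subset by blast
  fix x assume x: "x \<in> closure S"
  then obtain f where f: "\<And>n. f n \<in> S" "f \<longlonglongrightarrow> x" by (auto simp: closure_sequential)
  show "c *\<^sub>C x \<in> closure S" for c
    unfolding closure_sequential
    by (intro exI[of _ "\<lambda>n. c *\<^sub>C f n"] conjI allI complex_vector.subspace_scale[OF S] f(1)
        bounded_linear.tendsto[OF bounded_linear_scaleC f(2)])
  fix y assume y: "y \<in> closure S"
  then obtain g where g: "\<And>n. g n \<in> S" "g \<longlonglongrightarrow> y" by (auto simp: closure_sequential)
  show "x + y \<in> closure S"
    unfolding closure_sequential
    by (intro exI[of _ "\<lambda>n. f n + g n"] conjI allI complex_vector.subspace_add[OF S] f(1) g(1)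
        tendsto_add[OF f(2) g(2)])
qed

lemma onb_csubspace: "onb M E \<Longrightarrow> csubspace M"
  unfolding onb_iff using closure_csubspace[OF complex_vector.subspace_span] by blast

lemma onb_closed: "onb M E \<Longrightarrow> closed M"
  unfolding onb_iff by (metis closed_closure)

lemma closed_cinner_eq_0: "closed {x. cinner x y = 0}"
proof -
  \<comment> \<open>The second real condition is the vanishing of the imaginary part.\<close>
  have "{x. cinner x y = 0} = {x. inner x y = 0} \<inter> {x. inner x (\<i> *\<^sub>C y) = 0}"
    by (auto simp: inner_eq_Re_cinner cinner_simps complex_eq_iff)
  then show ?thesis
    by (simp, intro closed_Int closed_Collect_eq continuous_intros)
qed

lemma csubspace_cinner_eq_0: "csubspace {x. cinner x y = 0}"
  by (simp add: complex_vector.subspace_def cinner_simps)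

lemma cinner_cspan_eq_0:
  assumes "\<And>e. e \<in> E \<Longrightarrow> cinner e y = 0" and "x \<in> closure (cspan E)"
  shows "cinner x y = 0"
proof -
  have "cspan E \<subseteq> {x. cinner x y = 0}"
    by (rule complex_vector.span_minimal[OF _ csubspace_cinner_eq_0]) (use assms in blast)
  then have "closure (cspan E) \<subseteq> {x. cinner x y = 0}"
    by (rule closure_minimal[OF _ closed_cinner_eq_0])
  then show ?thesis using assms by blast
qed

text \<open>Zorn's lemma gives a maximal orthonormal family in \<open>M\<close>. If its closed span
  missed a vector of \<open>M\<close>, the normalised component orthogonal to that span would
  enlarge the family.\<close>

lemma onb_exists:
  fixes M :: "'a::chilbert_space set"
  assumes M: "csubspace M" "closed M"
  obtains E where "onb M E"
proof -
  have "\<exists>E\<in>{E. E \<subseteq> M \<and> orthonormal E}. \<forall>X\<in>{E. E \<subseteq> M \<and> orthonormal E}. E \<subseteq> X \<longrightarrow> X = E"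
  proof (rule subset_Zorn')
    fix C assume C: "subset.chain {E. E \<subseteq> M \<and> orthonormal E} C"
    have "cinner e f = (if e = f then 1 else 0)" if "e \<in> X" "f \<in> Y" "X \<in> C" "Y \<in> C" for e f X Y
    proof -
      have "X \<subseteq> Y \<or> Y \<subseteq> X" "orthonormal X" "orthonormal Y"
        using C that unfolding subset_chain_def by blast+
      then show ?thesis using that by (auto simp: orthonormal_def)
    qed
    then have "orthonormal (\<Union>C)" unfolding orthonormal_def by (meson UnionE)
    then show "\<Union>C \<in> {E. E \<subseteq> M \<and> orthonormal E}" using C by (auto simp: subset_chain_def)
  qed
  then obtain E where E: "E \<subseteq> M" "orthonormal E"
    and max: "\<And>X. X \<subseteq> M \<Longrightarrow> orthonormal X \<Longrightarrow> E \<subseteq> X \<Longrightarrow> X = E" by auto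
  define N where "N = closure (cspan E)"
  have N: "csubspace N" "closed N"
    unfolding N_def using closure_csubspace[OF complex_vector.subspace_span] by auto
  have "N \<subseteq> M" unfolding N_def
    by (intro closure_minimal complex_vector.span_minimal E M)
  have EN: "E \<subseteq> N" unfolding N_def using complex_vector.span_superset closure_subset by blast
  have "x \<in> N" if x: "x \<in> M" for x
  proof (rule ccontr)
    assume "x \<notin> N"
    define y where "y = x - orth_proj N x"
    have y0: "y \<noteq> 0" using \<open>x \<notin> N\<close> orth_proj_in[OF N, of x] by (auto simp: y_def)
    have yM: "y \<in> M" unfolding y_def
      using x orth_proj_in[OF N, of x] \<open>N \<subseteq> M\<close> M complex_vector.subspace_diff by blast
    define u where "u = complex_of_real (1 / norm y) *\<^sub>C y"
    have u0: "cinner e u = 0" if "e \<in> E" for e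
      using orth_proj_characterization[OF N, of x] that EN by (auto simp: u_def y_def cinner_simps)
    have "norm u = 1" using y0 by (simp add: u_def norm_scaleC norm_divide)
    then have uu: "cinner u u = 1" by (simp add: cinner_self)
    \<comment> \<open>Maximality puts \<open>u\<close> into \<open>E\<close>, although
      \<open>u\<close> is orthogonal to all of \<open>E\<close> and has norm 1.\<close>
    have "insert u E = E"
    proof (rule max)
      show "insert u E \<subseteq> M" using E yM M complex_vector.subspace_scale by (auto simp: u_def)
      show "orthonormal (insert u E)"
        using orthonormal_Un(1)[of E "{u}"] E(2) u0 uu by (simp add: orthonormal_def[of "{u}"])
    qed auto
    then show False using u0[of u] uu by auto
  qed
  then have "onb M E" using E \<open>N \<subseteq> M\<close> by (auto simp: onb_iff N_def)
  then show thesis by (rule that)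
qed

lemma onb_Un:
  fixes M N :: "'a::complex_inner set"
  assumes E: "onb M E" and F: "onb N F"
    and orth: "\<forall>x\<in>M. \<forall>y\<in>N. cinner x y = 0" and sum: "\<forall>z. \<exists>x\<in>M. \<exists>y\<in>N. z = x + y"
  shows "onb UNIV (E \<union> F)" "E \<inter> F = {}"
proof -
  have orthon: "orthonormal E" "orthonormal F" and sub: "E \<subseteq> M" "F \<subseteq> N"
    using E F by (auto simp: onb_iff)
  have EF: "cinner e f = 0" if "e \<in> E" "f \<in> F" for e f using orth that sub by blast
  note orthon' = orthonormal_Un[OF orthon EF]
  show "E \<inter> F = {}" by (rule orthon'(2))
  note orthon'(1)
  moreover have "closure (cspan (E \<union> F)) = UNIV"
  proof -
    have "M \<subseteq> closure (cspan (E \<union> F))" "N \<subseteq> closure (cspan (E \<union> F))"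
      using E F unfolding onb_iff by (metis closure_mono complex_vector.span_mono Un_upper1 Un_upper2)+
    then have "z \<in> closure (cspan (E \<union> F))" for z
      using spec[OF sum, of z] complex_vector.subspace_add[OF closure_csubspace[OF complex_vector.subspace_span]]
      by blast
    then show ?thesis by blast
  qed
  ultimately show "onb UNIV (E \<union> F)" by (simp add: onb_iff)
qed

section \<open>Finite expansions, Parseval's identity and basis independence of the trace\<close>

lemma orthonormal_expansion:
  assumes "finite F" "orthonormal F"
  defines "p \<equiv> \<lambda>x. \<Sum>e\<in>F. cinner e x *\<^sub>C e"
  shows "(norm x)\<^sup>2 = (\<Sum>e\<in>F. (cmod (cinner e x))\<^sup>2) + (norm (x - p x))\<^sup>2"
    and "y \<in> cspan F \<Longrightarrow> norm (x - p x) \<le> norm (x - y)"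
proof -
  have pf: "cinner f (p x) = cinner f x" if "f \<in> F" for f
  proof -
    have "cinner f (p x) = (\<Sum>e\<in>F. if f = e then cinner e x else 0)"
      unfolding p_def cinner_sum_right using assms(2) that
      by (intro sum.cong) (simp_all add: cinner_scaleC_right orthonormal_def)
    then show ?thesis using that assms(1) by simp
  qed
  have orth: "cinner y (x - p x) = 0" if "y \<in> cspan F" for y
    by (rule cinner_cspan_eq_0[OF _ subsetD[OF closure_subset that]]) (simp add: cinner_diff_right pf)
  have pF: "p x \<in> cspan F" unfolding p_def
    by (intro complex_vector.span_sum complex_vector.span_scale complex_vector.span_base)
  \<comment> \<open>Used twice: \<open>u = p x\<close> gives the norm identity,
    \<open>u = p x - y\<close> the best approximation property.\<close>
  have pyth: "(norm (u + (x - p x)))\<^sup>2 = (norm u)\<^sup>2 + (norm (x - p x))\<^sup>2" if "u \<in> cspan F" for u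
    using orth[OF that] by (simp add: power2_norm_eq_inner inner_add_left inner_add_right
        inner_commute[of "x - p x" u]) (simp add: inner_eq_Re_cinner)
  have "cinner (p x) x = (\<Sum>e\<in>F. cinner x e * cinner e x)"
  proof -
    have "cinner x (p x) = (\<Sum>e\<in>F. cinner e x * cinner x e)"
      by (simp add: p_def cinner_sum_right cinner_simps)
    then have "cnj (cinner x (p x)) = (\<Sum>e\<in>F. cnj (cinner e x * cinner x e))" by simp
    then show ?thesis by (simp add: cinner_commute[symmetric] )
  qed
  also have "\<dots> = complex_of_real (\<Sum>e\<in>F. (cmod (cinner e x))\<^sup>2)"
    unfolding of_real_sum
    by (intro sum.cong refl) (metis cinner_commute complex_norm_square mult.commute)
  finally have "cinner (p x) (p x) = complex_of_real (\<Sum>e\<in>F. (cmod (cinner e x))\<^sup>2)"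
    using orth[OF pF] by (simp add: cinner_diff_right)
  then have "(norm (p x))\<^sup>2 = (\<Sum>e\<in>F. (cmod (cinner e x))\<^sup>2)"
    by (simp only: cinner_self of_real_eq_iff)
  then show "(norm x)\<^sup>2 = (\<Sum>e\<in>F. (cmod (cinner e x))\<^sup>2) + (norm (x - p x))\<^sup>2"
    using pyth[OF pF] by simp
  show "norm (x - p x) \<le> norm (x - y)" if "y \<in> cspan F"
  proof -
    have "p x - y \<in> cspan F" using pF that by (rule complex_vector.span_diff)
    then have "(norm (x - p x))\<^sup>2 \<le> (norm (x - y))\<^sup>2" using pyth[of "p x - y"] by simp
    then show ?thesis by (simp add: power_mono_iff)
  qed
qed

text \<open>One finite combination \<open>y\<close> within \<open>sqrt r\<close> of \<open>x\<close>
  suffices: every finite \<open>Y\<close> containing its support has \<open>y\<close> in its span,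
  so by best approximation the squared remainder stays below \<open>r\<close>.\<close>

lemma Parseval_has_sum:
  assumes E: "onb M E" and x: "x \<in> M"
  shows "((\<lambda>e. (cmod (cinner e x))\<^sup>2) has_sum (norm x)\<^sup>2) E"
  unfolding has_sum_def tendsto_iff eventually_finite_subsets_at_top
proof (intro allI impI)
  fix r :: real assume r: "r > 0"
  have "x \<in> closure (cspan E)" using E x by (simp add: onb_iff)
  then obtain y where y: "y \<in> cspan E" "dist y x < sqrt r"
    using r unfolding closure_approachable by (meson real_sqrt_gt_0_iff)
  obtain t c where t: "finite t" "t \<subseteq> E" "y = (\<Sum>a\<in>t. c a *\<^sub>C a)"
    using y(1) unfolding complex_vector.span_explicit by blast
  show "\<exists>X. finite X \<and> X \<subseteq> E \<and> (\<forall>Y. finite Y \<and> X \<subseteq> Y \<and> Y \<subseteq> E \<longrightarrow>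
      dist (\<Sum>e\<in>Y. (cmod (cinner e x))\<^sup>2) ((norm x)\<^sup>2) < r)"
  proof (intro exI[of _ t] conjI allI impI t)
    fix Y assume Y: "finite Y \<and> t \<subseteq> Y \<and> Y \<subseteq> E"
    have "orthonormal Y" using E Y unfolding onb_iff orthonormal_def by (meson subsetD)
    note ex = orthonormal_expansion[OF conjunct1[OF Y] this]
    have "y \<in> cspan Y" unfolding t(3)
      using Y by (intro complex_vector.span_sum complex_vector.span_scale complex_vector.span_base) blast
    from ex(2)[OF this, of x] y(2)
    have "norm (x - (\<Sum>e\<in>Y. cinner e x *\<^sub>C e)) < sqrt r" by (simp add: dist_norm norm_minus_commute)
    then have "(norm (x - (\<Sum>e\<in>Y. cinner e x *\<^sub>C e)))\<^sup>2 < (sqrt r)\<^sup>2"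
      by (intro power_strict_mono) auto
    then show "dist (\<Sum>e\<in>Y. (cmod (cinner e x))\<^sup>2) ((norm x)\<^sup>2) < r"
      using ex(1)[of x] r by (simp add: dist_real_def)
  qed
qed

text \<open>The nonnegative double family
  \<open>\<bar>\<langle>f, A e\<rangle>\<bar>\<^sup>2\<close> is summed in both orders. By Parseval
  the inner sums are the squared norms of \<open>A e\<close> in one order and of \<open>B f\<close>
  in the other.\<close>

lemma Hilbert_Schmidt_adjoint_has_sum:
  assumes E: "onb M E" and F: "onb N F"
    and A: "\<And>x. x \<in> M \<Longrightarrow> A x \<in> N" and B: "\<And>y. y \<in> N \<Longrightarrow> B y \<in> M"
    and adj: "\<And>x y. x \<in> M \<Longrightarrow> y \<in> N \<Longrightarrow> cinner (A x) y = cinner x (B y)"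
    and sum: "((\<lambda>e. (norm (A e))\<^sup>2) has_sum s) E"
  shows "((\<lambda>f. (norm (B f))\<^sup>2) has_sum s) F"
proof -
  have sub: "E \<subseteq> M" "F \<subseteq> N" using E F by (auto simp: onb_iff)
  define g where "g = (\<lambda>(e, f). (cmod (cinner f (A e)))\<^sup>2)"
  have row: "((\<lambda>f. g (e, f)) has_sum (norm (A e))\<^sup>2) F" if "e \<in> E" for e
    unfolding g_def using Parseval_has_sum[OF F] A sub that by auto
  have "g summable_on E \<times> F"
    by (rule summable_on_SigmaI[OF row has_sum_imp_summable[OF sum]]) (auto simp: g_def)
  then have "(g has_sum s) (E \<times> F)" using has_sum_SigmaI[OF row sum] by blast
  then have swapped: "((\<lambda>(f, e). g (e, f)) has_sum s) (F \<times> E)" by (subst (asm) has_sum_swap)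
  have col: "((\<lambda>e. g (e, f)) has_sum (norm (B f))\<^sup>2) E" if f: "f \<in> F" for f
  proof -
    have "g (e, f) = (cmod (cinner e (B f)))\<^sup>2" if "e \<in> E" for e
    proof -
      have "cinner (A e) f = cinner e (B f)" using adj that f sub by blast
      then have "cinner f (A e) = cnj (cinner e (B f))" by (metis cinner_commute)
      then show ?thesis by (simp add: g_def)
    qed
    moreover have "((\<lambda>e. (cmod (cinner e (B f)))\<^sup>2) has_sum (norm (B f))\<^sup>2) E"
      using Parseval_has_sum[OF E] B f sub by blast
    ultimately show ?thesis by (simp cong: has_sum_cong)
  qed
  show ?thesis by (rule has_sum_SigmaD[OF swapped]) (simp add: col)
qed

text \<open>With \<open>S\<close> the root of \<open>T\<close> the diagonal entries are
  \<open>(norm (S e))\<^sup>2\<close>. The sum is carried from \<open>E\<close> to a basis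
  \<open>G\<close> of the whole space and back to \<open>F\<close>; since \<open>S\<close> may leave
  \<open>M\<close>, the adjoint of its restriction to \<open>M\<close> is the projection composed
  with \<open>S\<close>.\<close>

lemma positive_op_trace_basis_independent:
  fixes T :: "'a::chilbert_space \<Rightarrow> 'a"
  assumes T: "positive_op UNIV T" and E: "onb M E" and F: "onb M F"
    and sum: "((\<lambda>e. Re (cinner e (T e))) has_sum s) E"
  shows "((\<lambda>e. Re (cinner e (T e))) has_sum s) F"
proof -
  note M = onb_csubspace[OF E] onb_closed[OF E]
  note U = complex_vector.subspace_UNIV closed_UNIV
  obtain S where S: "positive_op UNIV S" "\<And>x. S (S x) = T x" using positive_op_sqrt_exists[OF T] by metis
  have sym: "cinner (S x) y = cinner x (S y)" for x y using positive_op_cinner[OF U S(1)] by simp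
  have "complex_of_real ((norm (S x))\<^sup>2) = cinner x (T x)" for x
    by (metis cinner_self sym S(2))
  then have sq: "Re (cinner x (T x)) = (norm (S x))\<^sup>2" for x by (metis Re_complex_of_real)
  obtain G :: "'a set" where G: "onb UNIV G" using onb_exists[OF U] .
  have adj: "cinner (S x) y = cinner x (orth_proj M (S y))" if "x \<in> M" for x y
    using that by (simp add: cinner_orth_proj_right[OF M] sym)
  have "((\<lambda>g. (norm (orth_proj M (S g)))\<^sup>2) has_sum s) G"
    by (rule Hilbert_Schmidt_adjoint_has_sum[OF E G, of S])
      (use sum in \<open>simp_all add: orth_proj_in[OF M] adj sq\<close>)
  then have "((\<lambda>f. (norm (S f))\<^sup>2) has_sum s) F"
    by (rule Hilbert_Schmidt_adjoint_has_sum[OF G F, rotated -1])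
      (simp_all add: orth_proj_in[OF M] cinner_orth_proj_left[OF M] sym)
  then show ?thesis by (simp add: sq)
qed

section \<open>Positive elements of the predual\<close>

lemma bounded_op_block:
  fixes M :: "'a::chilbert_space set"
  assumes M: "csubspace M" "closed M" and A: "bounded_op UNIV UNIV A"
  shows "bounded_op M M (block M A)"
  unfolding block_def
  using bounded_op_compose[OF bounded_op_mono[OF A subset_UNIV subset_UNIV] bounded_op_orth_proj[OF M]] .

lemma positive_op_block:
  fixes M :: "'a::chilbert_space set"
  assumes M: "csubspace M" "closed M" and T: "positive_op UNIV T"
  shows "positive_op M (block M T)"
proof (rule positive_opI[OF M(1)])
  show "bounded_op M M (block M T)"
    using T by (intro bounded_op_block M) (simp add: positive_op_def)
  show "cinner (block M T x) y = cinner x (block M T y)" if "x \<in> M" "y \<in> M" for x y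
    using that positive_op_cinner[OF complex_vector.subspace_UNIV closed_UNIV T UNIV_I UNIV_I, of x y]
    by (simp add: block_def cinner_orth_proj_left[OF M] cinner_orth_proj_right[OF M])
  show "0 \<le> Re (cinner x (block M T x))" if "x \<in> M" for x
    using that T by (simp add: block_def cinner_orth_proj_right[OF M] positive_op_def)
qed

text \<open>Makes the whole space an instance of the block results below.\<close>

lemma block_UNIV: "block UNIV A = (A :: 'a::complex_inner \<Rightarrow> 'a)"
  by (simp add: block_def orth_proj_id fun_eq_iff)

lemma skew_adjoint_cinner:
  fixes a :: "'a::chilbert_space \<Rightarrow> 'a"
  assumes "bounded_op UNIV UNIV a" "skew_adjoint a"
  shows "cinner (a x) y = - cinner x (a y)"
  using adj_characterization[OF complex_vector.subspace_UNIV closed_UNIV assms(1), of y] assms(2)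
  by (simp add: skew_adjoint_def cinner_minus_right)

text \<open>Since \<open>a\<close> is skew-adjoint, its block \<open>b\<close> satisfies
  \<open>b\<^sup>* b = - b\<^sup>2 = (\<i> b)\<^sup>2\<close>, and \<open>\<i> b\<close> is positive
  as a compression of a positive operator.\<close>

lemma abs_op_block:
  fixes M :: "'a::chilbert_space set"
  assumes M: "csubspace M" "closed M" and a: "bounded_op UNIV UNIV a" "skew_adjoint a"
    and T: "positive_op UNIV (\<lambda>x. \<i> *\<^sub>C a x)" and x: "x \<in> M"
  shows "abs_op M (block M a) x = block M (\<lambda>x. \<i> *\<^sub>C a x) x"
proof (rule abs_op_eqI[OF M positive_op_block[OF M T] _ x])
  fix y assume y: "y \<in> M"
  note P = bounded_op_orth_proj[OF M] orth_proj_in[OF M]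
  have P_scale: "orth_proj M (c *\<^sub>C u) = c *\<^sub>C orth_proj M u" for c u
    using bounded_op_scaleC[OF P(1) UNIV_I] .
  have P_minus: "orth_proj M (- u) = - orth_proj M u" for u
    using P_scale[of "- 1" u] by (simp add: complex_vector.scale_minus_left scaleC_one)
  have a_scale: "a (c *\<^sub>C u) = c *\<^sub>C a u" for c u using bounded_op_scaleC[OF a(1) UNIV_I] .
  have "adj M (block M a) (block M a y) = - block M a (block M a y)"
  proof (rule adj_eqI[OF M(1)])
    show "- block M a (block M a y) \<in> M"
      unfolding block_def by (intro complex_vector.subspace_neg M P)
    show "cinner (block M a u) (block M a y) = cinner u (- block M a (block M a y))" if "u \<in> M" for u
      using that by (simp add: block_def cinner_orth_proj_left[OF M P(2)] cinner_minus_right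
          cinner_orth_proj_right[OF M] skew_adjoint_cinner[OF a])
  qed
  moreover have "block M (\<lambda>x. \<i> *\<^sub>C a x) (block M (\<lambda>x. \<i> *\<^sub>C a x) y) = - block M a (block M a y)"
    by (simp add: block_def P_scale P_minus a_scale scaleC_scaleC complex_vector.scale_minus_left scaleC_one)
  ultimately show "block M (\<lambda>x. \<i> *\<^sub>C a x) (block M (\<lambda>x. \<i> *\<^sub>C a x) y) = adj M (block M a) (block M a y)"
    by simp
qed

text \<open>Against \<open>e\<close> in \<open>M\<close> the projection in the block disappears, so
  both blocks and the whole operator share the single diagonal of \<open>\<i> a\<close>.\<close>

lemma Re_cinner_abs_op_block:
  fixes M :: "'a::chilbert_space set"
  assumes "csubspace M" "closed M" "bounded_op UNIV UNIV a" "skew_adjoint a"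
    and "positive_op UNIV (\<lambda>x. \<i> *\<^sub>C a x)" and "e \<in> M"
  shows "Re (cinner e (abs_op M (block M a) e)) = Re (cinner e (\<i> *\<^sub>C a e))"
  using assms by (simp add: abs_op_block block_def cinner_orth_proj_right)

lemma trace_class_block_iff:
  fixes M :: "'a::chilbert_space set"
  assumes "csubspace M" "closed M" "bounded_op UNIV UNIV a" "skew_adjoint a"
    and "positive_op UNIV (\<lambda>x. \<i> *\<^sub>C a x)"
  shows "trace_class M (block M a) \<longleftrightarrow>
    (\<exists>E s. onb M E \<and> ((\<lambda>e. Re (cinner e (\<i> *\<^sub>C a e))) has_sum s) E)"
proof -
  have "(\<lambda>e. Re (cinner e (abs_op M (block M a) e))) summable_on E \<longleftrightarrow>
      (\<lambda>e. Re (cinner e (\<i> *\<^sub>C a e))) summable_on E" if "onb M E" for E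
    using that by (intro summable_on_cong Re_cinner_abs_op_block assms) (auto simp: onb_iff)
  then show ?thesis
    unfolding trace_class_def summable_on_def[symmetric] ex_simps
    using bounded_op_block[OF assms(1-3)] by auto
qed

text \<open>\<open>trace_norm\<close> sums over an unspecified basis; basis independence lets it be
  read off from any convenient \<open>E\<close>.\<close>

lemma trace_norm_block_eq:
  fixes M :: "'a::chilbert_space set"
  assumes a: "bounded_op UNIV UNIV a" "skew_adjoint a"
    and T: "positive_op UNIV (\<lambda>x. \<i> *\<^sub>C a x)" and E: "onb M E"
    and sum: "((\<lambda>e. Re (cinner e (\<i> *\<^sub>C a e))) has_sum s) E"
  shows "trace_norm M (block M a) = s"
proof -
  note M = onb_csubspace[OF E] onb_closed[OF E]
  define F where "F = (SOME F. onb M F)"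
  have F: "onb M F" unfolding F_def using E by (rule someI)
  have "trace_norm M (block M a) = (\<Sum>\<^sub>\<infinity>e\<in>F. Re (cinner e (\<i> *\<^sub>C a e)))"
    unfolding trace_norm_def F_def[symmetric] using F
    by (intro infsum_cong Re_cinner_abs_op_block M a T) (auto simp: onb_iff)
  also have "\<dots> = s"
    by (rule infsumI[OF positive_op_trace_basis_independent[OF T E F sum]])
  finally show ?thesis .
qed

section \<open>The Hilbert-Schmidt bound for an off-diagonal block\<close>

lemma positive_op_cinner_le:
  fixes T :: "'a::chilbert_space \<Rightarrow> 'a"
  assumes T: "positive_op UNIV T"
  shows "(cmod (cinner x (T y)))\<^sup>2 \<le> Re (cinner x (T x)) * Re (cinner y (T y))"
proof -
  obtain S where S: "positive_op UNIV S" "\<And>x. S (S x) = T x" using positive_op_sqrt_exists[OF T] by metis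
  have sym: "cinner (S x) y = cinner x (S y)" for x y
    using positive_op_cinner[OF complex_vector.subspace_UNIV closed_UNIV S(1)] by simp
  have "complex_of_real ((norm (S x))\<^sup>2) = cinner x (T x)" for x by (metis cinner_self sym S(2))
  then have sq: "Re (cinner x (T x)) = (norm (S x))\<^sup>2" for x by (metis Re_complex_of_real)
  \<comment> \<open>Cauchy-Schwarz for \<open>S x\<close> and \<open>S y\<close>, since
    \<open>\<langle>x, T y\<rangle> = \<langle>S x, S y\<rangle>\<close>.\<close>
  have "cmod (cinner x (T y)) \<le> norm (S x) * norm (S y)"
    using cinner_Cauchy_Schwarz[of "S x" "S y"] by (simp add: sym S(2))
  then have "(cmod (cinner x (T y)))\<^sup>2 \<le> (norm (S x) * norm (S y))\<^sup>2" by (rule power_mono) simp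
  then show ?thesis by (simp add: sq power_mult_distrib)
qed

text \<open>Parseval in \<open>E\<close> expands the norm of the block at \<open>f\<close>, and
  Cauchy-Schwarz for the form of \<open>T\<close> bounds each coefficient by a product. Summing over
  \<open>E\<close> gives \<open>s\<close> times the diagonal entry at \<open>f\<close>, and summing
  over \<open>G\<close> gives \<open>s * t\<close>.\<close>

lemma hs_norm_off_diagonal_le:
  fixes M N :: "'a::chilbert_space set"
  assumes T: "positive_op UNIV T" and E: "onb M E" and F: "onb N F"
    and sE: "((\<lambda>e. Re (cinner e (T e))) has_sum s) E" and sF: "((\<lambda>e. Re (cinner e (T e))) has_sum t) F"
  shows "hs_norm N (block M T) \<le> sqrt (s * t)"
proof -
  note M = onb_csubspace[OF E] onb_closed[OF E]
  define G where "G = (SOME G. onb N G)"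
  have G: "onb N G" unfolding G_def using F by (rule someI)
  have sG: "((\<lambda>e. Re (cinner e (T e))) has_sum t) G"
    by (rule positive_op_trace_basis_independent[OF T F G sF])
  have le: "(norm (block M T f))\<^sup>2 \<le> s * Re (cinner f (T f))" for f
  proof (rule has_sum_mono)
    show "((\<lambda>e. (cmod (cinner e (block M T f)))\<^sup>2) has_sum (norm (block M T f))\<^sup>2) E"
      using Parseval_has_sum[OF E orth_proj_in[OF M]] by (simp add: block_def)
    show "((\<lambda>e. Re (cinner e (T e)) * Re (cinner f (T f))) has_sum s * Re (cinner f (T f))) E"
      by (rule has_sum_cmult_left[OF sE])
    show "(cmod (cinner e (block M T f)))\<^sup>2 \<le> Re (cinner e (T e)) * Re (cinner f (T f))" if "e \<in> E" for e
    proof -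
      have "e \<in> M" using that E by (auto simp: onb_iff)
      then show ?thesis
        using positive_op_cinner_le[OF T, of e f] by (simp add: block_def cinner_orth_proj_right[OF M])
    qed
  qed
  have sG': "((\<lambda>f. s * Re (cinner f (T f))) has_sum s * t) G" by (rule has_sum_cmult_right[OF sG])
  have "(\<lambda>f. (norm (block M T f))\<^sup>2) summable_on G"
    by (rule summable_on_comparison_test[OF has_sum_imp_summable[OF sG'] le]) simp
  then have "(\<Sum>\<^sub>\<infinity>f\<in>G. (norm (block M T f))\<^sup>2) \<le> s * t"
    by (rule has_sum_mono[OF has_sum_infsum sG' le])
  then show ?thesis by (simp add: hs_norm_def G_def)
qed

section \<open>Differences of positive operators with finite trace\<close>

text \<open>
  The kernel of \<open>R - A\<close> and its orthogonal complement reduce \<open>A\<close>: on the former \<open>R = A\<close>, on the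
  latter \<open>R = - A\<close>. In a basis adapted to this splitting the diagonal of \<open>R = |A|\<close> is, up to signs,
  that of \<open>A = T\<^sub>1 - T\<^sub>2\<close>.
\<close>

lemma abs_diff_positive_summable:
  fixes R :: "'a::chilbert_space \<Rightarrow> 'a"
  assumes R: "positive_op UNIV R" and T1: "positive_op UNIV T1" and T2: "positive_op UNIV T2"
    and RR: "\<And>x. R (R x) = A (A x)" and comm: "\<And>x. A (R x) = R (A x)" and A: "\<And>x. A x = T1 x - T2 x"
    and E1: "onb UNIV E1" "((\<lambda>e. Re (cinner e (T1 e))) has_sum s) E1"
    and E2: "onb UNIV E2" "((\<lambda>e. Re (cinner e (T2 e))) has_sum t) E2"
  obtains E where "onb UNIV E" "(\<lambda>e. Re (cinner e (R e))) summable_on E"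
proof -
  have bop: "bounded_linear R" "bounded_linear T1" "bounded_linear T2"
    and scale: "\<And>c x. R (c *\<^sub>C x) = c *\<^sub>C R x" "\<And>c x. T1 (c *\<^sub>C x) = c *\<^sub>C T1 x" "\<And>c x. T2 (c *\<^sub>C x) = c *\<^sub>C T2 x"
    using R T1 T2 by (auto simp: positive_op_def bounded_op_iff)
  have blA: "bounded_linear A" using bounded_linear_sub[OF bop(2,3)] by (simp add: A[abs_def])
  note add = linear_add[OF bounded_linear.linear[OF bop(1)]] linear_add[OF bounded_linear.linear[OF blA]]
  have A_scale: "A (c *\<^sub>C x) = c *\<^sub>C A x" for c x
    by (simp add: A scale complex_vector.scale_right_diff_distrib)
  note sym' = positive_op_cinner[OF complex_vector.subspace_UNIV closed_UNIV _ UNIV_I UNIV_I]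
  have symA: "cinner (A x) y = cinner x (A y)" for x y
    by (simp add: A cinner_diff_left cinner_diff_right sym'[OF T1] sym'[OF T2])
  define K where "K = {x. R x = A x}"
  have K: "csubspace K" "closed K"
  proof -
    show "csubspace K"
      using linear_0[OF bounded_linear.linear[OF bop(1)]] linear_0[OF bounded_linear.linear[OF blA]]
      by (auto simp: K_def complex_vector.subspace_def add scale A_scale)
    show "closed K" unfolding K_def
      by (intro closed_Collect_eq linear_continuous_on bop blA)
  qed
  define L where "L = {x. \<forall>y\<in>K. cinner x y = 0}"
  have "L = (\<Inter>y\<in>K. {x. cinner x y = 0})" by (auto simp: L_def)
  then have "closed L" by (simp add: closed_INT closed_cinner_eq_0)
  moreover have "csubspace L"
    by (auto simp: L_def complex_vector.subspace_def cinner_simps)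
  ultimately have L: "csubspace L" "closed L" by auto
  have R_on_L: "R x = - A x" if "x \<in> L" for x
  proof -
    define y where "y = R x + A x"
    \<comment> \<open>Commutation and \<open>R\<^sup>2 = A\<^sup>2\<close> give
      \<open>(R - A) (R + A) = 0\<close>, so \<open>R + A\<close> maps everything into
      \<open>K\<close>. As \<open>y\<close> is itself \<open>(R + A) x\<close>, symmetry turns its
      squared norm into the product of \<open>x\<close> in \<open>L\<close> with a vector of
      \<open>K\<close>.\<close>
    have "R y + A y \<in> K" by (simp add: K_def add comm RR)
    then have "cinner x (R y + A y) = 0" using that by (auto simp: L_def)
    moreover have "cinner y y = cinner x (R y + A y)"
      by (subst (1) y_def) (simp only: cinner_add_left cinner_add_right sym'[OF R] symA)
    ultimately have "cinner y y = 0" by simp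
    then show ?thesis by (simp add: cinner_self y_def eq_neg_iff_add_eq_0)
  qed
  obtain EK where EK: "onb K EK" using onb_exists[OF K] .
  obtain EL where EL: "onb L EL" using onb_exists[OF L] .
  define E where "E = EK \<union> EL"
  have E: "onb UNIV E" unfolding E_def
  proof (rule onb_Un(1)[OF EK EL])
    show "\<forall>x\<in>K. \<forall>y\<in>L. cinner x y = 0"
      using cinner_commute_eq_0 unfolding L_def by blast
    show "\<forall>z. \<exists>x\<in>K. \<exists>y\<in>L. z = x + y"
    proof (intro allI bexI)
      fix z
      show "z = orth_proj K z + (z - orth_proj K z)" by simp
      show "z - orth_proj K z \<in> L"
        using orth_proj_characterization[OF K, of z] cinner_commute_eq_0 unfolding L_def by blast
    qed (rule orth_proj_in[OF K])
  qed
  \<comment> \<open>Basis independence carries both traces, given in unrelated bases, to the adapted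
    basis; their sum is the dominating series.\<close>
  have "((\<lambda>e. Re (cinner e (T1 e)) + Re (cinner e (T2 e))) has_sum s + t) E"
    by (intro has_sum_add positive_op_trace_basis_independent[OF T1 E1(1) E E1(2)]
        positive_op_trace_basis_independent[OF T2 E2(1) E E2(2)])
  then have "(\<lambda>e. Re (cinner e (R e))) summable_on E"
  proof (rule summable_on_comparison_test[OF has_sum_imp_summable])
    fix e assume "e \<in> E"
    then have "R e = A e \<or> R e = - A e"
      using EK EL R_on_L by (auto simp: E_def onb_iff K_def)
    moreover have "0 \<le> Re (cinner e (T1 e))" "0 \<le> Re (cinner e (T2 e))"
      using T1 T2 by (auto simp: positive_op_def)
    ultimately show "Re (cinner e (R e)) \<le> Re (cinner e (T1 e)) + Re (cinner e (T2 e))"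
      by (auto simp: A cinner_diff_right cinner_minus_right)
    show "0 \<le> Re (cinner e (R e))" using R by (simp add: positive_op_def)
  qed
  then show thesis by (rule that[OF E])
qed

text \<open>With \<open>A = \<i> \<rho>\<close> one has
  \<open>\<rho>\<^sup>* \<rho> = - \<rho>\<^sup>2 = A\<^sup>2\<close>, so the absolute value of
  \<open>\<rho>\<close> is the positive root \<open>R\<close> of \<open>A\<^sup>2\<close>, and the
  summability of its diagonal is the preceding result.\<close>

lemma trace_class_skew_diff_positive:
  fixes \<rho> :: "'a::chilbert_space \<Rightarrow> 'a"
  assumes \<rho>: "bounded_op UNIV UNIV \<rho>" "skew_adjoint \<rho>"
    and T1: "positive_op UNIV T1" and T2: "positive_op UNIV T2"
    and A: "\<And>x. \<i> *\<^sub>C \<rho> x = T1 x - T2 x"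
    and E1: "onb UNIV E1" "((\<lambda>e. Re (cinner e (T1 e))) has_sum s) E1"
    and E2: "onb UNIV E2" "((\<lambda>e. Re (cinner e (T2 e))) has_sum t) E2"
  shows "trace_class UNIV \<rho>"
proof -
  note U = complex_vector.subspace_UNIV closed_UNIV
  define A where "A = (\<lambda>x. \<i> *\<^sub>C \<rho> x)"
  have bl: "bounded_linear \<rho>" and scale: "\<And>c x. \<rho> (c *\<^sub>C x) = c *\<^sub>C \<rho> x"
    using \<rho> by (auto simp: bounded_op_iff)
  have blA: "bounded_linear A"
    unfolding A_def by (rule bounded_linear_compose[OF bounded_linear_scaleC bl])
  have boA: "bounded_op UNIV UNIV A"
    using blA by (simp add: bounded_op_iff) (simp add: A_def scale scaleC_scaleC mult.commute)
  have symA: "cinner (A x) y = cinner x (A y)" for x y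
    by (simp add: A_def cinner_simps skew_adjoint_cinner[OF \<rho>])
  have AA: "A (A x) = adj UNIV \<rho> (\<rho> x)" for x
    using \<rho>(2) by (simp add: A_def skew_adjoint_def scale scaleC_scaleC complex_vector.scale_minus_left scaleC_one)
  have pos: "positive_op UNIV (\<lambda>x. A (A x))"
  proof (rule positive_opI)
    show "bounded_op UNIV UNIV (\<lambda>x. A (A x))" by (rule bounded_op_compose[OF boA boA])
    show "0 \<le> Re (cinner x (A (A x)))" for x
      by (simp add: symA[symmetric] cinner_self)
  qed (simp_all add: symA)
  obtain R where R: "positive_op UNIV R" "\<And>x. R (R x) = A (A x)"
    and comm: "\<forall>C. bounded_linear C \<longrightarrow> (\<forall>x. C (A (A x)) = A (A (C x))) \<longrightarrow> (\<forall>x. C (R x) = R (C x))"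
    by (rule positive_op_sqrt_exists[OF pos]) (rule that)
  \<comment> \<open>\<open>A\<close> commutes with its own square, hence with the root of that
    square.\<close>
  have AR: "A (R x) = R (A x)" for x using comm blA by blast
  obtain E where E: "onb UNIV E" "(\<lambda>e. Re (cinner e (R e))) summable_on E"
    by (rule abs_diff_positive_summable[OF R(1) T1 T2 R(2) AR _ E1 E2]) (simp add: A_def A, rule that)
  have "abs_op UNIV \<rho> x = R x" for x
    by (rule abs_op_eqI[OF U R(1) _ UNIV_I]) (simp add: R(2) AA)
  then show ?thesis using E \<rho>(1) by (auto simp: trace_class_def)
qed

section \<open>Adapted bases for positive elements of the predual, and the two assertions\<close>

lemma u_res_predual_positive_trace:
  fixes Hp Hm :: "'a::chilbert_space set"
  assumes Hp: "csubspace Hp" "closed Hp" and Hm: "csubspace Hm" "closed Hm"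
    and orth: "\<forall>x\<in>Hp. \<forall>y\<in>Hm. cinner x y = 0"
    and sum: "\<forall>z. \<exists>x\<in>Hp. \<exists>y\<in>Hm. z = x + y"
    and a: "a \<in> u_res_predual Hp Hm" and T: "positive_op UNIV (\<lambda>x. \<i> *\<^sub>C a x)"
  obtains E F s t where "onb Hp E" "onb Hm F" "onb UNIV (E \<union> F)"
    "((\<lambda>e. Re (cinner e (\<i> *\<^sub>C a e))) has_sum s) E" "((\<lambda>e. Re (cinner e (\<i> *\<^sub>C a e))) has_sum t) F"
    "((\<lambda>e. Re (cinner e (\<i> *\<^sub>C a e))) has_sum (s + t)) (E \<union> F)"
proof -
  have bo: "bounded_op UNIV UNIV a" and skew: "skew_adjoint a"
    and tc: "trace_class Hp (block Hp a)" "trace_class Hm (block Hm a)"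
    using a by (auto simp: u_res_predual_def)
  obtain E s where E: "onb Hp E" "((\<lambda>e. Re (cinner e (\<i> *\<^sub>C a e))) has_sum s) E"
    using tc(1) trace_class_block_iff[OF Hp bo skew T] by blast
  obtain F t where F: "onb Hm F" "((\<lambda>e. Re (cinner e (\<i> *\<^sub>C a e))) has_sum t) F"
    using tc(2) trace_class_block_iff[OF Hm bo skew T] by blast
  \<comment> \<open>The bases of \<open>Hp\<close> and \<open>Hm\<close> are disjoint and form a
    basis of the whole space, so the traces of the two blocks add up to the trace of
    \<open>\<i> a\<close>.\<close>
  note EF = onb_Un[OF E(1) F(1) orth sum]
  show thesis
    by (rule that[OF E(1) F(1) EF(1) E(2) F(2) has_sum_Un_disjoint[OF E(2) F(2) EF(2)]])
qed

theorem proposition6p4: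
  fixes Hp Hm :: "'a::chilbert_space set"
  assumes "separable_space (euclidean :: 'a topology)"
    and "csubspace Hp" and "closed Hp" and "\<nexists>B. finite B \<and> cspan B = Hp"
    and "csubspace Hm" and "closed Hm" and "\<nexists>B. finite B \<and> cspan B = Hm"
    and "\<forall>x\<in>Hp. \<forall>y\<in>Hm. cinner x y = 0"
    and "\<forall>z. \<exists>x\<in>Hp. \<exists>y\<in>Hm. z = x + y"
  shows "(\<forall>a\<in>u_res_predual Hp Hm. positive_op UNIV (\<lambda>x. \<i> *\<^sub>C a x) \<longrightarrow>
            trace_class UNIV a \<and>
            trace_norm UNIV a \<le> u_res_predual_norm Hp Hm a \<and>
            u_res_predual_norm Hp Hm a \<le> (1 + sqrt 2) * trace_norm UNIV a) \<and>
         (\<forall>\<rho>\<in>u_res_predual Hp Hm - u_1.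
            \<not> (\<exists>\<rho>1\<in>u_res_predual Hp Hm. \<exists>\<rho>2\<in>u_res_predual Hp Hm.
                 positive_op UNIV (\<lambda>x. \<i> *\<^sub>C \<rho>1 x) \<and> positive_op UNIV (\<lambda>x. \<i> *\<^sub>C \<rho>2 x) \<and>
                 \<rho> = (\<lambda>x. \<rho>1 x - \<rho>2 x)))"
proof (intro conjI ballI impI)
  note Hp = assms(2,3) and Hm = assms(5,6)
  note U = complex_vector.subspace_UNIV closed_UNIV
  note trace = u_res_predual_positive_trace[OF Hp Hm assms(8,9)]
  {
    fix a assume a: "a \<in> u_res_predual Hp Hm" and T: "positive_op UNIV (\<lambda>x. \<i> *\<^sub>C a x)"
    have bo: "bounded_op UNIV UNIV a" and skew: "skew_adjoint a"
      using a by (auto simp: u_res_predual_def)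
    obtain E F s t where E: "onb Hp E" and F: "onb Hm F" and EF: "onb UNIV (E \<union> F)"
      and s: "((\<lambda>e. Re (cinner e (\<i> *\<^sub>C a e))) has_sum s) E"
      and t: "((\<lambda>e. Re (cinner e (\<i> *\<^sub>C a e))) has_sum t) F"
      and st: "((\<lambda>e. Re (cinner e (\<i> *\<^sub>C a e))) has_sum (s + t)) (E \<union> F)"
      by (rule trace[OF a T])
    show "trace_class UNIV a"
      using trace_class_block_iff[OF U bo skew T] EF st unfolding block_UNIV by blast
    have norms: "trace_norm UNIV a = s + t" "trace_norm Hp (block Hp a) = s" "trace_norm Hm (block Hm a) = t"
      using trace_norm_block_eq[OF bo skew T EF st] trace_norm_block_eq[OF bo skew T E s]
        trace_norm_block_eq[OF bo skew T F t] by (simp_all add: block_UNIV)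
    have nonneg: "0 \<le> Re (cinner x (\<i> *\<^sub>C a x))" for x using T by (simp add: positive_op_def)
    have st0: "0 \<le> s" "0 \<le> t"
      using has_sum_nonneg[OF s nonneg] has_sum_nonneg[OF t nonneg] by auto
    \<comment> \<open>The unimodular factor \<i> leaves Hilbert-Schmidt norms unchanged, so the
      bound for the positive operator applies to \<open>a\<close>.\<close>
    have "block Hp (\<lambda>x. \<i> *\<^sub>C a x) x = \<i> *\<^sub>C block Hp a x" for x
      by (simp add: block_def bounded_op_scaleC[OF bounded_op_orth_proj[OF Hp]])
    then have "hs_norm Hm (block Hp a) = hs_norm Hm (block Hp (\<lambda>x. \<i> *\<^sub>C a x))"
      by (simp add: hs_norm_def norm_scaleC)
    also have "\<dots> \<le> sqrt (s * t)" by (rule hs_norm_off_diagonal_le[OF T E F s t])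
    also have "\<dots> \<le> (s + t) / 2" by (rule arith_geo_mean_sqrt[OF st0])
    finally have hs: "2 * hs_norm Hm (block Hp a) \<le> s + t" by simp
    have "0 \<le> hs_norm Hm (block Hp a)" by (simp add: hs_norm_def infsum_nonneg)
    \<comment> \<open>The diagonal part of the predual norm already equals \<open>s + t\<close>, the
      trace norm; the off-diagonal term only adds to it.\<close>
    then show "trace_norm UNIV a \<le> u_res_predual_norm Hp Hm a"
      by (simp add: u_res_predual_norm_def norms)
    \<comment> \<open>The estimate \<open>hs\<close> bounds the predual norm by
      \<open>2 * (s + t)\<close>, and \<open>2 \<le> 1 + sqrt 2\<close>.\<close>
    have "1 * (s + t) \<le> sqrt 2 * (s + t)" using st0 by (intro mult_right_mono) auto
    then show "u_res_predual_norm Hp Hm a \<le> (1 + sqrt 2) * trace_norm UNIV a"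
      using hs by (simp add: u_res_predual_norm_def norms distrib_right)
  }
  fix \<rho> assume \<rho>: "\<rho> \<in> u_res_predual Hp Hm - u_1"
  show "\<not> (\<exists>\<rho>1\<in>u_res_predual Hp Hm. \<exists>\<rho>2\<in>u_res_predual Hp Hm.
      positive_op UNIV (\<lambda>x. \<i> *\<^sub>C \<rho>1 x) \<and> positive_op UNIV (\<lambda>x. \<i> *\<^sub>C \<rho>2 x) \<and>
      \<rho> = (\<lambda>x. \<rho>1 x - \<rho>2 x))"
  proof clarify
    fix \<rho>1 \<rho>2
    assume \<rho>1: "\<rho>1 \<in> u_res_predual Hp Hm" "positive_op UNIV (\<lambda>x. \<i> *\<^sub>C \<rho>1 x)"
      and \<rho>2: "\<rho>2 \<in> u_res_predual Hp Hm" "positive_op UNIV (\<lambda>x. \<i> *\<^sub>C \<rho>2 x)"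
      and eq: "\<rho> = (\<lambda>x. \<rho>1 x - \<rho>2 x)"
    have bo: "bounded_op UNIV UNIV \<rho>" and skew: "skew_adjoint \<rho>" and "\<rho> \<notin> u_1"
      using \<rho> by (auto simp: u_res_predual_def)
    \<comment> \<open>Here \<open>s\<close> stands for the full trace of
      \<open>\<i> \<rho>1\<close>, the sum of its two block traces, taken in the combined
      basis.\<close>
    obtain E1 s where E1: "onb UNIV E1" "((\<lambda>e. Re (cinner e (\<i> *\<^sub>C \<rho>1 e))) has_sum s) E1"
      using trace[OF \<rho>1] by metis
    obtain E2 t where E2: "onb UNIV E2" "((\<lambda>e. Re (cinner e (\<i> *\<^sub>C \<rho>2 e))) has_sum t) E2"
      using trace[OF \<rho>2] by metis
    have "trace_class UNIV \<rho>"
      by (rule trace_class_skew_diff_positive[OF bo skew \<rho>1(2) \<rho>2(2) _ E1 E2])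
        (simp add: eq complex_vector.scale_right_diff_distrib)
    then show False using skew \<open>\<rho> \<notin> u_1\<close> by (simp add: u_1_def)
  qed
qed

end
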